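(* Let $\psi\in\mathbb{L}_1\cap C^2(\mathrm{int}(\mathrm{dom}\,\psi))$ and $\psi^*\in\mathbb{L}_1\cap C^2(\mathrm{int}(\mathrm{dom}\,\psi^* ))$ (where $\psi^*$ is the convex conjugate of $\psi$), and let $b\in\mathcal{B}\subseteq\mathrm{dom}\,\psi^*$, where $\mathrm{int}(\mathrm{dom}\,\psi^* )=\mathrm{int}(B)$ and $\mathcal{B}\subseteq\mathrm{dom}\,\psi^*\subseteq B$ with $B=\mathrm{cl}(\mathrm{conv}\,\mathcal{B})$. Let $\nabla\psi(\theta)=\mu\in\mathrm{int}(\mathrm{dom}\,\psi^* )$ be the first cumulant. Under the regularity condition $\nabla^2\psi(\theta)=V(\nabla\psi(\theta))>0$ for all $\theta\in\mathrm{int}(\mathrm{dom}\,\psi)$, we have $$d_{\psi^*}(b;\theta)=D_{\psi^*}(b|\mu)=-\sigma^2Q(b;\mu).$$ Therefore, when $\mathrm{dom}\,\psi=\mathrm{int}(\mathrm{dom}\,\psi)$, the log-concave density function $p_Q(b;\mu,\sigma^2)=\exp(Q(b;\mu))\,p_0(b,\sigma^2)$ is a regular $2$-LED model with the mean-variance relation $\nabla^2\psi(\theta)=V(\nabla\psi(\theta))$. Here $p_0(b,\sigma^2)$ is a base measure satisfying $\int_{\mathcal{B}}p_Q(b;\mu,\sigma^2)\,\nu(db)=1$.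
   Context: Everything is one-dimensional ($\mathcal{B}\subseteq\mathbb{R}$, $b$ a random variable). $\mathrm{dom} f=\{x\in\mathbb{R} : f(x)<+\infty\}$; int, cl, bd, conv denote interior, closure, boundary and convex hull. The conjugate is $f^*(x)=\sup_t xt-f(t)$. $\mathcal{B}$ is the set of observations (values of $b$); $\mathbf{E}[b]$ is the expectation of the observations. Legendre functions: $\mathbb{L}_n$ is the class of lower semicontinuous, convex, proper functions $f:\mathrm{dom} f\subseteq\mathbb{R}^n\to\mathbb{R}$ such that (i) $\mathrm{int}(\mathrm{dom} f)\neq\emptyset$ and $f\in C^1(\mathrm{int}(\mathrm{dom} f))$; (ii) $f$ is strictly convex on $\mathrm{int}(\mathrm{dom} f)$; (iii) (steepness) for all $x\in\mathrm{bd}(\mathrm{dom} f)$ and $y\in\mathrm{int}(\mathrm{dom} f)$, $\lim_{t\downarrow0}\langle\nabla f(x+t(y-x)),y-x\rangle=-\infty$. Bregman divergence associated with $f$: $D_f(x|y)=f(x)-f(y)-\langle x-y,\nabla f(y)\rangle$ for $(x,y)\in\mathrm{dom} f\times\mathrm{int}(\mathrm{dom} f)$. Canonical divergence: $d_f(x;\theta)=D_f(x|\nabla f^*(\theta))=f(x)+f^*(\theta)-\langle x,\theta\rangle$, so $d_{\psi^*}(b;\theta)=\psi^*(b)+\psi(\theta)-b\theta$. Quasi-likelihood function: $Q(b;\mu)=-\int_\mu^b\frac{b-x}{\sigma^2V(x)}\,dx$, where $\sigma^2>0$ is a dispersion parameter (constant) and $V$ is a unit variance function, with mean-variance relation $var(b)=\sigma^2V(\mu)$,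 $\mu=\mathbf{E}[b]$. Log-concave density function: $g(x)=\exp(-f(x))$ with $f\in\mathbb{L}_n$ and $\int g(x)\,\nu(dx)=1$, where $\nu(dx)$ is an appropriate continuous Lebesgue (or discrete counting) measure. In the parameterized densities here, a base measure factor $p_0(b,\sigma^2)$, depending only on $b$ and $\sigma^2$, is used together with $\nu$ to normalize. K-LED (Legendre exponential dispersion model with $K$ cumulants, $K\ge1$): for $\psi\in\mathbb{L}_n\cap C^K(\mathrm{int}(\mathrm{dom}\,\psi))$ with $\nabla\psi(\theta)=\mathbf{E}[b]$, and $\mathcal{B}$ satisfying $\mathrm{int}(\mathrm{dom}\,\psi^* )=\mathrm{int}(B)$, $\mathcal{B}\subseteq\mathrm{dom}\,\psi^*\subseteq B$, it is the density $$p_\psi(b;\theta,\sigma^2)=\exp\!\left(\frac{\langle b,\theta\rangle-\psi(\theta)}{\sigma^2}\right)p_1(b,\sigma^2),$$ where $\sigma^2>0$ is a dispersion parameter, $\mathrm{dom}\,\psi$ is the canonical parameter space, $\mathrm{dom}\,\psi^*$ is the mean parameter space, and $p_1(b,\sigma^2)$ is a base measure satisfying $\int_{\mathcal{B}}p_\psi(b;\theta,\sigma^2)\,\nu(db)=1$. The function $K_\psi(x;\theta,\sigma^2)=\sigma^{-2}(\psi(\theta+x\sigma^2)-\psi(\theta))$ is its cumulant generating function up to the $K$-th cumulant (so for $K\ge 2$, $var(b)=\sigma^2\nabla^2\psi(\theta)$). The model is regular if $\mathrm{dom}\,\psi$ is open and non-regular otherwise. The density $p_Q(b;\mu,\sigma^2)$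 is viewed as parameterized by $\theta$ through $\mu=\nabla\psi(\theta)$. *)

theory Defs
  imports "HOL-Probability.Probability"
begin

definition eff_dom :: "(real \<Rightarrow> ereal) \<Rightarrow> real set" where
  "eff_dom f = {x. f x < \<infinity>}"

text \<open>The finite part of an extended-real function; only meaningful on \<open>eff_dom f\<close>
  (it is \<open>0\<close> where \<open>f\<close> is infinite). Derivatives are taken of this function, at points of
  \<open>interior (eff_dom f)\<close>.\<close>

definition fin :: "(real \<Rightarrow> ereal) \<Rightarrow> real \<Rightarrow> real" where
  "fin f x = real_of_ereal (f x)"

definition proper_fun :: "(real \<Rightarrow> ereal) \<Rightarrow> bool" where
  "proper_fun f \<longleftrightarrow> eff_dom f \<noteq> {} \<and> (\<forall>x. f x \<noteq> - \<infinity>)"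

definition lsc_fun :: "(real \<Rightarrow> ereal) \<Rightarrow> bool" where
  "lsc_fun f \<longleftrightarrow> (\<forall>x. f x \<le> Liminf (at x) f)"

definition strictly_convex_on :: "real set \<Rightarrow> (real \<Rightarrow> real) \<Rightarrow> bool" where
  "strictly_convex_on S g \<longleftrightarrow> convex S \<and>
     (\<forall>x\<in>S. \<forall>y\<in>S. \<forall>u. x \<noteq> y \<longrightarrow> 0 < u \<longrightarrow> u < 1 \<longrightarrow>
        g ((1 - u) * x + u * y) < (1 - u) * g x + u * g y)"

text \<open>Class \<open>C\<^sup>k\<close>; only meaningful for open \<open>S\<close>, since \<open>deriv\<close> is two-sided.\<close>

definition C_on :: "nat \<Rightarrow> real set \<Rightarrow> (real \<Rightarrow> real) \<Rightarrow> bool" where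
  "C_on k S g \<longleftrightarrow>
     (\<forall>j<k. \<forall>x\<in>S. (deriv ^^ j) g field_differentiable (at x)) \<and>
     (\<forall>j\<le>k. continuous_on S ((deriv ^^ j) g))"

definition steep :: "(real \<Rightarrow> ereal) \<Rightarrow> bool" where
  "steep f \<longleftrightarrow>
     (\<forall>x\<in>frontier (eff_dom f). \<forall>y\<in>interior (eff_dom f).
        filterlim (\<lambda>t. deriv (fin f) (x + t * (y - x)) * (y - x)) at_bot (at_right 0))"

definition legendre :: "(real \<Rightarrow> ereal) \<Rightarrow> bool" where
  "legendre f \<longleftrightarrow>
     proper_fun f \<and> lsc_fun f \<and> convex_on (eff_dom f) (fin f) \<and>
     interior (eff_dom f) \<noteq> {} \<and> C_on 1 (interior (eff_dom f)) (fin f) \<and>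
     strictly_convex_on (interior (eff_dom f)) (fin f) \<and>
     steep f"

definition conjugate :: "(real \<Rightarrow> ereal) \<Rightarrow> real \<Rightarrow> ereal" where
  "conjugate f x = (SUP t. ereal (x * t) - f t)"

text \<open>Meaningful for \<open>x \<in> eff_dom f\<close> and \<open>y \<in> interior (eff_dom f)\<close>.\<close>

definition bregman :: "(real \<Rightarrow> ereal) \<Rightarrow> real \<Rightarrow> real \<Rightarrow> real" where
  "bregman f x y = fin f x - fin f y - (x - y) * deriv (fin f) y"

definition canonical_div :: "(real \<Rightarrow> ereal) \<Rightarrow> real \<Rightarrow> real \<Rightarrow> real" where
  "canonical_div f x \<theta> = bregman f x (deriv (fin (conjugate f)) \<theta>)"

text \<open>The interval integral is oriented and taken over the open interval between the endpoints, so
  that \<open>V\<close> is not evaluated at \<open>b\<close>, which may lie on the boundary of the mean parameter space.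
  Throughout, \<open>\<sigma>2\<close> is the dispersion parameter \<open>\<sigma>\<^sup>2\<close>.\<close>

definition quasi_lik :: "(real \<Rightarrow> real) \<Rightarrow> real \<Rightarrow> real \<Rightarrow> real \<Rightarrow> real" where
  "quasi_lik V \<sigma>2 b \<mu> = - (LBINT x=\<mu>..b. (b - x) / (\<sigma>2 * V x))"

definition reference_measure :: "real measure \<Rightarrow> real set \<Rightarrow> bool" where
  "reference_measure \<nu> \<B> \<longleftrightarrow> (\<nu> = lebesgue \<or> \<nu> = count_space UNIV) \<and> \<B> \<in> sets \<nu>"

text \<open>A Bochner integral equal to \<open>1\<close> is the integral of an integrable function, so measurability
  on \<open>\<B>\<close> is part of \<open>is_density\<close>.\<close>

definition is_density :: "real measure \<Rightarrow> real set \<Rightarrow> (real \<Rightarrow> real) \<Rightarrow> bool" where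
  "is_density \<nu> \<B> p \<longleftrightarrow> (\<forall>b\<in>\<B>. 0 \<le> p b) \<and> (LINT b:\<B>|\<nu>. p b) = 1"

definition law :: "real measure \<Rightarrow> real set \<Rightarrow> (real \<Rightarrow> real) \<Rightarrow> real measure" where
  "law \<nu> \<B> p = density (restrict_space \<nu> \<B>) (\<lambda>b. ennreal (p b))"

definition mean_is :: "real measure \<Rightarrow> real \<Rightarrow> bool" where
  "mean_is M m \<longleftrightarrow> integrable M (\<lambda>b. b) \<and> (\<integral>b. b \<partial>M) = m"

definition variance_is :: "real measure \<Rightarrow> real \<Rightarrow> bool" where
  "variance_is M v \<longleftrightarrow>
     integrable M (\<lambda>b. b) \<and> integrable M (\<lambda>b. b\<^sup>2) \<and> prob_space.variance M (\<lambda>b. b) = v"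

definition cgf :: "real measure \<Rightarrow> real \<Rightarrow> real" where
  "cgf M x = ln (\<integral>b. exp (x * b) \<partial>M)"

text \<open>\<open>k\<close> is the cumulant generating function of \<open>M\<close> up to the \<open>K\<close>-th cumulant: the first \<open>K\<close>
  cumulants of \<open>M\<close>, i.e. the derivatives at \<open>0\<close> of \<open>cgf M\<close>, exist and are those of \<open>k\<close>. At an
  interior canonical parameter of an LED, finiteness of the exponential moments near \<open>0\<close> is no extra
  restriction: it follows from the normalization at the nearby parameters.\<close>

definition is_cgf_upto :: "nat \<Rightarrow> real measure \<Rightarrow> (real \<Rightarrow> real) \<Rightarrow> bool" where
  "is_cgf_upto K M k \<longleftrightarrow>
     (\<exists>e>0. (\<forall>x\<in>ball 0 e. integrable M (\<lambda>b. exp (x * b))) \<and>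
            C_on K (ball 0 e) (cgf M) \<and> C_on K (ball 0 e) k) \<and>
     (\<forall>j\<le>K. (deriv ^^ j) (cgf M) 0 = (deriv ^^ j) k 0)"

text \<open>Log-concavity is relative to the base measure \<open>h(b) \<nu>(db)\<close>.\<close>

definition log_concave_density ::
    "real measure \<Rightarrow> real set \<Rightarrow> (real \<Rightarrow> real) \<Rightarrow> (real \<Rightarrow> real) \<Rightarrow> bool" where
  "log_concave_density \<nu> \<B> h p \<longleftrightarrow>
     is_density \<nu> \<B> p \<and>
     (\<exists>f. legendre f \<and> \<B> \<subseteq> eff_dom f \<and> (\<forall>b\<in>\<B>. p b = exp (- fin f b) * h b))"

text \<open>The set \<open>B\<close> of the observation condition is the closed convex hull of \<open>\<B>\<close>.\<close>

definition observation_cond :: "(real \<Rightarrow> ereal) \<Rightarrow> real set \<Rightarrow> bool" where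
  "observation_cond \<psi> \<B> \<longleftrightarrow>
     interior (eff_dom (conjugate \<psi>)) = interior (closure (convex hull \<B>)) \<and>
     \<B> \<subseteq> eff_dom (conjugate \<psi>) \<and> eff_dom (conjugate \<psi>) \<subseteq> closure (convex hull \<B>)"

definition K_fun :: "(real \<Rightarrow> ereal) \<Rightarrow> real \<Rightarrow> real \<Rightarrow> real \<Rightarrow> real" where
  "K_fun \<psi> \<theta> \<sigma>2 x = (fin \<psi> (\<theta> + x * \<sigma>2) - fin \<psi> \<theta>) / \<sigma>2"

text \<open>\<open>p b \<theta> \<sigma>2\<close> is the density at \<open>b\<close>; the base measure \<open>p1\<close> does not depend on \<open>\<theta>\<close>.\<close>

definition LED ::
    "nat \<Rightarrow> (real \<Rightarrow> ereal) \<Rightarrow> real set \<Rightarrow> real measure \<Rightarrow> real \<Rightarrow>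
     (real \<Rightarrow> real \<Rightarrow> real \<Rightarrow> real) \<Rightarrow> bool" where
  "LED K \<psi> \<B> \<nu> \<sigma>2 p \<longleftrightarrow>
     K \<ge> 1 \<and> \<sigma>2 > 0 \<and> legendre \<psi> \<and> C_on K (interior (eff_dom \<psi>)) (fin \<psi>) \<and>
     observation_cond \<psi> \<B> \<and> reference_measure \<nu> \<B> \<and>
     (\<exists>p1. (\<forall>b\<in>\<B>. 0 \<le> p1 b \<sigma>2) \<and>
        (\<forall>\<theta>\<in>eff_dom \<psi>. \<forall>b\<in>\<B>. p b \<theta> \<sigma>2 = exp ((b * \<theta> - fin \<psi> \<theta>) / \<sigma>2) * p1 b \<sigma>2)) \<and>
     (\<forall>\<theta>\<in>eff_dom \<psi>. is_density \<nu> \<B> (\<lambda>b. p b \<theta> \<sigma>2)) \<and>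
     (\<forall>\<theta>\<in>interior (eff_dom \<psi>).
        mean_is (law \<nu> \<B> (\<lambda>b. p b \<theta> \<sigma>2)) (deriv (fin \<psi>) \<theta>) \<and>
        is_cgf_upto K (law \<nu> \<B> (\<lambda>b. p b \<theta> \<sigma>2)) (K_fun \<psi> \<theta> \<sigma>2))"

definition regular_LED ::
    "nat \<Rightarrow> (real \<Rightarrow> ereal) \<Rightarrow> real set \<Rightarrow> real measure \<Rightarrow> real \<Rightarrow>
     (real \<Rightarrow> real \<Rightarrow> real \<Rightarrow> real) \<Rightarrow> bool" where
  "regular_LED K \<psi> \<B> \<nu> \<sigma>2 p \<longleftrightarrow> LED K \<psi> \<B> \<nu> \<sigma>2 p \<and> open (eff_dom \<psi>)"

definition p_Q ::
    "(real \<Rightarrow> real) \<Rightarrow> (real \<Rightarrow> real \<Rightarrow> real) \<Rightarrow> real \<Rightarrow> real \<Rightarrow> real \<Rightarrow> real" where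
  "p_Q V p0 b \<mu> \<sigma>2 = exp (quasi_lik V \<sigma>2 b \<mu>) * p0 b \<sigma>2"

end

theory Submission
  imports Defs
begin

text \<open>The gradient \<open>\<psi>'\<close> is a bijection from the interior of the domain of \<open>\<psi>\<close> onto the interior of
  the domain of its conjugate, with inverse the gradient of the conjugate
  (\<open>gradient_surj\<close>, \<open>gradient_in_interior\<close>, \<open>deriv_conjugate_gradient\<close>). Hence the second derivative
  of the conjugate at \<open>x = \<psi>' \<theta>\<close> is \<open>1 / \<psi>'' \<theta> = 1 / V x\<close>, and the quasi-likelihood integrand
  \<open>(b - x) / V x\<close> is that of the second-order Taylor remainder of the conjugate. This remainder is
  the Bregman divergence (\<open>bregman_eq_integral\<close>). The only delicate end is \<open>b\<close>, which may be a
  boundary point of the dual domain, where derivatives may blow up; there convexity and lower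
  semicontinuity still force the divergence to vanish in the limit (\<open>bregman_tendsto_0\<close>).

  By conjugate duality the same divergence is \<open>\<psi>* b + \<psi> \<theta> - b * \<theta>\<close>. So \<open>exp Q\<close> is, up to the factor
  \<open>exp (- \<psi>* b / \<sigma>\<^sup>2)\<close>, which goes into the base measure, the exponential family generated by \<open>\<psi>\<close>;
  and it is log-concave because \<open>- Q\<close> is a rescaled conjugate plus an affine function, again
  a Legendre function (\<open>legendre_scale_add_affine\<close>). Normalization at every parameter turns into a formula
  for the moment generating function of each member, since exponential tilting moves one member to
  another one (\<open>integral_exp_law\<close>). The cumulant generating function is thus
  \<open>K_fun\<close> exactly, near \<open>0\<close>, and its derivatives yield mean and variance
  (\<open>integral_id_exp\<close>, \<open>integral_sq\<close>).\<close>

section \<open>Derivatives and convexity\<close>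

lemma C_on_1D:
  assumes "C_on 1 S f" "x \<in> S"
  shows "(f has_real_derivative deriv f x) (at x)"
  using assms unfolding C_on_def by (auto simp: DERIV_deriv_iff_field_differentiable)

lemma C_on_2D:
  assumes "C_on 2 S f" "x \<in> S"
  shows "(f has_real_derivative deriv f x) (at x)"
    and "(deriv f has_real_derivative (deriv ^^ 2) f x) (at x)"
proof -
  have D: "(deriv ^^ j) f field_differentiable at x" if "j < 2" for j
    using assms that unfolding C_on_def by blast
  show "(f has_real_derivative deriv f x) (at x)"
    using D[of 0] by (simp add: DERIV_deriv_iff_field_differentiable)
  show "(deriv f has_real_derivative (deriv ^^ 2) f x) (at x)"
    using D[of 1] by (simp add: DERIV_deriv_iff_field_differentiable numeral_2_eq_2)
qed

lemma C_on_2_continuous: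
  assumes "C_on 2 S f"
  shows "continuous_on S ((deriv ^^ 2) f)"
  using assms unfolding C_on_def by blast

lemma C_on_1I:
  assumes "open S" "\<And>x. x \<in> S \<Longrightarrow> (f has_real_derivative f' x) (at x)"
    and "continuous_on S f'"
  shows "C_on 1 S f"
proof -
  have d: "deriv f x = f' x" if "x \<in> S" for x
    using assms(2)[OF that] by (rule DERIV_imp_deriv)
  have "continuous_on S f"
    using assms(2) by (auto intro!: continuous_at_imp_continuous_on DERIV_isCont)
  moreover have "continuous_on S (deriv f)"
    using assms(3) d by (simp cong: continuous_on_cong)
  moreover have "f field_differentiable at x" if "x \<in> S" for x
    using assms(2)[OF that] field_differentiable_def by blast
  moreover have "j \<le> 1 \<longleftrightarrow> j = 0 \<or> j = 1" "j < 1 \<longleftrightarrow> j = 0" for j :: nat by linarith+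
  ultimately show ?thesis unfolding C_on_def by simp
qed

lemma C_on_2I:
  assumes S: "open S" and f: "\<And>x. x \<in> S \<Longrightarrow> (f has_real_derivative f' x) (at x)"
    and f': "\<And>x. x \<in> S \<Longrightarrow> (f' has_real_derivative f'' x) (at x)"
    and "continuous_on S f''"
  shows "C_on 2 S f" "\<And>x. x \<in> S \<Longrightarrow> (deriv ^^ 2) f x = f'' x"
proof -
  have d: "deriv f x = f' x" if "x \<in> S" for x
    using f[OF that] by (rule DERIV_imp_deriv)
  have d1: "(deriv f has_real_derivative f'' x) (at x)" if "x \<in> S" for x
    by (rule has_field_derivative_transform_within_open[OF f'[OF that] S that]) (simp add: d)
  show d2: "(deriv ^^ 2) f x = f'' x" if "x \<in> S" for x
    using DERIV_imp_deriv[OF d1[OF that]] by (simp add: numeral_2_eq_2)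
  have "continuous_on S f" "continuous_on S (deriv f)"
    using f d1 by (auto intro!: continuous_at_imp_continuous_on DERIV_isCont)
  moreover have "continuous_on S ((deriv ^^ 2) f)"
    using assms(4) d2 by (simp cong: continuous_on_cong)
  moreover have "f field_differentiable at x" "deriv f field_differentiable at x" if "x \<in> S" for x
    using f[OF that] d1[OF that] field_differentiable_def by blast+
  moreover have "j \<le> 2 \<longleftrightarrow> j = 0 \<or> j = 1 \<or> j = 2" "j < 2 \<longleftrightarrow> j = 0 \<or> j = 1" for j :: nat
    by linarith+
  ultimately show "C_on 2 S f" unfolding C_on_def by auto
qed

lemma eff_dom_finite:
  assumes "proper_fun f" "x \<in> eff_dom f"
  shows "f x = ereal (fin f x)"
  using assms unfolding proper_fun_def eff_dom_def fin_def
  by (cases "f x") auto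

lemma legendre_convex_dom: "legendre f \<Longrightarrow> convex (eff_dom f)"
  unfolding legendre_def convex_on_def by blast

lemma legendre_has_deriv:
  assumes "legendre f" "x \<in> interior (eff_dom f)"
  shows "(fin f has_real_derivative deriv (fin f) x) (at x)"
  using assms C_on_1D unfolding legendre_def by blast

lemma legendre_tangent:
  assumes "legendre f" "y \<in> interior (eff_dom f)" "x \<in> eff_dom f"
  shows "fin f y + deriv (fin f) y * (x - y) \<le> fin f x"
proof -
  have "fin f x - fin f y \<ge> deriv (fin f) y * (x - y)"
  proof (rule convex_on_imp_above_tangent)
    show "convex_on (eff_dom f) (fin f)" using assms(1) unfolding legendre_def by blast
    show "connected (eff_dom f)" using legendre_convex_dom[OF assms(1)] by (rule convex_connected)
    show "(fin f has_real_derivative deriv (fin f) y) (at y within eff_dom f)"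
      using legendre_has_deriv[OF assms(1,2)] by (rule has_field_derivative_at_within)
  qed (use assms in auto)
  then show ?thesis by simp
qed

lemma legendre_deriv_mono:
  assumes "legendre f" "x \<in> interior (eff_dom f)" "y \<in> interior (eff_dom f)" "x \<le> y"
  shows "deriv (fin f) x \<le> deriv (fin f) y"
proof -
  have "fin f y + deriv (fin f) y * (x - y) \<le> fin f x"
    "fin f x + deriv (fin f) x * (y - x) \<le> fin f y"
    using assms legendre_tangent interior_subset by (meson subsetD)+
  then have "deriv (fin f) x * (y - x) \<le> deriv (fin f) y * (y - x)"
    by (simp add: algebra_simps)
  then show ?thesis using assms(4)
    by (cases "x = y") (auto simp: mult_le_cancel_right)
qed

lemma legendre_second_deriv_nonneg:
  assumes "legendre f" "C_on 2 (interior (eff_dom f)) (fin f)" "x \<in> interior (eff_dom f)"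
  shows "0 \<le> (deriv ^^ 2) (fin f) x"
proof (rule mono_on_imp_deriv_nonneg)
  show "mono_on (interior (eff_dom f)) (deriv (fin f))"
    using assms(1) legendre_deriv_mono by (auto intro!: mono_onI)
qed (use C_on_2D(2)[OF assms(2,3)] assms(3) in auto)

section \<open>Conjugate duality on the interiors\<close>

lemma fenchel_young:
  assumes "proper_fun f" "t \<in> eff_dom f" "conjugate f x < \<infinity>"
  shows "x * t \<le> fin f t + fin (conjugate f) x"
proof -
  have le: "ereal (x * t) - f t \<le> conjugate f x"
    unfolding conjugate_def by (rule SUP_upper) simp
  then have "ereal (x * t - fin f t) \<le> conjugate f x"
    using eff_dom_finite[OF assms(1,2)] by simp
  then show ?thesis using assms(3) unfolding fin_def
    by (cases "conjugate f x") auto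
qed

lemma conjugate_gradient:
  assumes f: "legendre f" and y: "y \<in> interior (eff_dom f)"
  shows "conjugate f (deriv (fin f) y) = ereal (deriv (fin f) y * y - fin f y)"
proof (rule antisym)
  have P: "proper_fun f" using f unfolding legendre_def by blast
  show "conjugate f (deriv (fin f) y) \<le> ereal (deriv (fin f) y * y - fin f y)"
    unfolding conjugate_def
  proof (rule SUP_least)
    fix t
    show "ereal (deriv (fin f) y * t) - f t \<le> ereal (deriv (fin f) y * y - fin f y)"
    proof (cases "t \<in> eff_dom f")
      case True
      then show ?thesis
        using legendre_tangent[OF f y True] eff_dom_finite[OF P True] by (simp add: algebra_simps)
    next
      case False
      then have "f t = \<infinity>" unfolding eff_dom_def by simp
      then show ?thesis by simp
    qed
  qed
  have "f y = ereal (fin f y)"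
    using y interior_subset eff_dom_finite[OF P] by blast
  then have "ereal (deriv (fin f) y * y - fin f y) = ereal (deriv (fin f) y * y) - f y" by simp
  also have "\<dots> \<le> conjugate f (deriv (fin f) y)"
    unfolding conjugate_def by (rule SUP_upper) simp
  finally show "ereal (deriv (fin f) y * y - fin f y) \<le> conjugate f (deriv (fin f) y)" .
qed

lemma gradient_in_dom:
  assumes "legendre f" "y \<in> interior (eff_dom f)"
  shows "deriv (fin f) y \<in> eff_dom (conjugate f)"
    and "fin (conjugate f) (deriv (fin f) y) = deriv (fin f) y * y - fin f y"
  using conjugate_gradient[OF assms] unfolding eff_dom_def fin_def by auto

text \<open>The supremum defining the biconjugate at \<open>y\<close> is attained at the slope of \<open>f\<close> at \<open>y\<close>.\<close>

lemma biconjugate_interior: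
  assumes f: "legendre f" and y: "y \<in> interior (eff_dom f)"
  shows "conjugate (conjugate f) y = f y"
proof (rule antisym)
  have P: "proper_fun f" using f unfolding legendre_def by blast
  have fy: "f y = ereal (fin f y)"
    using y interior_subset eff_dom_finite[OF P] by blast
  show "conjugate (conjugate f) y \<le> f y"
    unfolding conjugate_def[of "conjugate f"]
  proof (rule SUP_least)
    fix t
    have "ereal (t * y) - f y \<le> conjugate f t"
      unfolding conjugate_def by (rule SUP_upper) simp
    then show "ereal (y * t) - conjugate f t \<le> f y"
      unfolding fy by (cases "conjugate f t") (auto simp: algebra_simps)
  qed
  have "f y = ereal (y * deriv (fin f) y) - conjugate f (deriv (fin f) y)"
    using conjugate_gradient[OF f y] fy by (simp add: algebra_simps)
  also have "\<dots> \<le> conjugate (conjugate f) y"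
    unfolding conjugate_def[of "conjugate f"] by (rule SUP_upper) simp
  finally show "f y \<le> conjugate (conjugate f) y" .
qed

lemma deriv_biconjugate:
  assumes "legendre f" "y \<in> interior (eff_dom f)"
  shows "deriv (fin (conjugate (conjugate f))) y = deriv (fin f) y"
proof (rule deriv_cong_ev)
  have "\<forall>\<^sub>F z in nhds y. z \<in> interior (eff_dom f)"
    using assms(2) by (simp add: eventually_nhds_in_open)
  then show "\<forall>\<^sub>F z in nhds y. fin (conjugate (conjugate f)) z = fin f z"
    by eventually_elim (simp add: fin_def biconjugate_interior[OF assms(1)])
qed simp

text \<open>A slope bound in the direction \<open>d\<close> is impossible at interior points \<open>x\<close> of the dual domain:
  if the ray from the domain in direction \<open>d\<close> leaves the domain, steepness makes the slopes
  unbounded at the boundary point that it meets; if it never leaves, then \<open>f\<close> grows along it at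
  a rate at most \<open>d * x\<close>, so that the conjugate is infinite just beyond \<open>x\<close>.\<close>

lemma slopes_exceed:
  assumes f: "legendre f" and x: "x \<in> interior (eff_dom (conjugate f))"
    and d: "\<bar>d\<bar> = (1::real)"
  shows "\<exists>t\<in>interior (eff_dom f). d * x \<le> d * deriv (fin f) t"
proof (rule ccontr)
  define S where "S = interior (eff_dom f)"
  assume "\<not> ?thesis"
  then have below: "d * deriv (fin f) t < d * x" if "t \<in> S" for t
    using that unfolding S_def by force
  have P: "proper_fun f" and st: "steep f" using f unfolding legendre_def by blast+
  have cS: "convex (eff_dom f)" "S \<subseteq> eff_dom f"
    using legendre_convex_dom[OF f] interior_subset unfolding S_def by blast+
  obtain y where y: "y \<in> S" using f unfolding legendre_def S_def by blast
  have dd: "d * d = 1" using d by (metis abs_mult_self_eq mult_1)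
  show False
  proof (cases "\<forall>t\<ge>0. y + t * d \<in> S")
    case True
    obtain e where e: "e > 0" "cball x e \<subseteq> eff_dom (conjugate f)"
      using x by (meson mem_interior_cball)
    define x' where "x' = x + d * e"
    have "x' \<in> cball x e" using e(1) d unfolding x'_def by (simp add: dist_real_def abs_mult)
    then have x': "conjugate f x' < \<infinity>" using e(2) unfolding eff_dom_def by auto
    define C where "C = fin (conjugate f) x' + fin f y - x' * y"
    have bnd: "e * t \<le> C" if "t \<ge> 0" for t
    proof -
      define z where "z = y + t * d"
      have z: "z \<in> S" using True that unfolding z_def by blast
      have "fin f z + deriv (fin f) z * (y - z) \<le> fin f y"
        using legendre_tangent[OF f] z y cS(2) unfolding S_def by blast
      then have "fin f z \<le> fin f y + t * (d * deriv (fin f) z)"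
        unfolding z_def by (simp add: algebra_simps)
      also have "\<dots> \<le> fin f y + t * (d * x)"
        using below[OF z] that by (simp add: mult_left_mono)
      finally have "fin f z \<le> fin f y + t * (d * x)" .
      moreover have "x' * z \<le> fin f z + fin (conjugate f) x'"
        using fenchel_young[OF P _ x'] z cS(2) by blast
      moreover have "x' * z = x' * y + t * (d * x) + (d * d) * (e * t)"
        unfolding z_def x'_def by (simp add: algebra_simps)
      ultimately show ?thesis unfolding C_def dd by simp
    qed
    have "e * ((\<bar>C\<bar> + 1) / e) \<le> C" by (rule bnd) (use e in simp)
    then show False using e by simp
  next
    case False
    then obtain s where s: "s \<ge> 0" "y + s * d \<notin> S" by blast
    have "(\<lambda>t. y + t * d) ` {0..s} \<inter> frontier S \<noteq> {}"
    proof (rule connected_Int_frontier)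
      show "connected ((\<lambda>t. y + t * d) ` {0..s})"
        by (intro connected_continuous_image continuous_intros connected_Icc)
      have "y \<in> (\<lambda>t. y + t * d) ` {0..s}" using s by force
      then show "(\<lambda>t. y + t * d) ` {0..s} \<inter> S \<noteq> {}" using y by blast
      show "(\<lambda>t. y + t * d) ` {0..s} - S \<noteq> {}" using s by force
    qed
    then obtain r where r: "0 \<le> r" "y + r * d \<in> frontier S" by auto
    define w where "w = y + r * d"
    have w: "w \<in> frontier (eff_dom f)"
      using r(2) frontier_interior_subset unfolding w_def S_def by blast
    have seg: "w + t * (y - w) \<in> S" if "0 < t" "t \<le> 1" for t
      using mem_interior_closure_convex_shrink[OF cS(1), of y w t] y w that
      unfolding S_def frontier_def by (simp add: algebra_simps)
    have "filterlim (\<lambda>t. deriv (fin f) (w + t * (y - w)) * (y - w)) at_bot (at_right 0)"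
      using st w y unfolding steep_def S_def by blast
    then have "\<forall>\<^sub>F t in at_right 0. deriv (fin f) (w + t * (y - w)) * (y - w) \<le> - r * (d * x) - 1"
      unfolding filterlim_at_bot by blast
    moreover have "\<forall>\<^sub>F t in at_right (0::real). 0 < t \<and> t \<le> 1"
      unfolding eventually_at_right_field by (rule exI[of _ 1]) auto
    ultimately have "\<forall>\<^sub>F t in at_right (0::real). False"
    proof eventually_elim
      case (elim t)
      let ?D = "deriv (fin f) (w + t * (y - w))"
      have "r * (d * ?D) \<le> r * (d * x)"
        using below[OF seg[of t]] elim(2) r(1)
        by (intro mult_left_mono[of "d * ?D"]) (auto intro: less_imp_le)
      moreover have "?D * (y - w) = - (r * (d * ?D))"
        unfolding w_def by (simp add: algebra_simps)
      ultimately show False using elim(1) by simp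
    qed
    then show False by simp
  qed
qed

text \<open>By \<open>slopes_exceed\<close> in both directions there are slopes on either side of \<open>x\<close>; the set of
  slopes is an interval.\<close>

lemma gradient_surj:
  assumes f: "legendre f" and x: "x \<in> interior (eff_dom (conjugate f))"
  shows "\<exists>t\<in>interior (eff_dom f). deriv (fin f) t = x"
proof -
  let ?S = "interior (eff_dom f)"
  obtain s t where "s \<in> ?S" "x \<le> deriv (fin f) s" "t \<in> ?S" "deriv (fin f) t \<le> x"
    using slopes_exceed[OF assms, of 1] slopes_exceed[OF assms, of "-1"] by auto
  moreover have "connected (deriv (fin f) ` ?S)"
  proof (rule connected_continuous_image)
    have "continuous_on ?S ((deriv ^^ 1) (fin f))"
      using f unfolding legendre_def C_on_def by blast
    then show "continuous_on ?S (deriv (fin f))" by simp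
    show "connected ?S" using f legendre_convex_dom convex_interior convex_connected by blast
  qed
  ultimately have "x \<in> deriv (fin f) ` ?S"
    by (meson connectedD_interval imageI)
  then show ?thesis by blast
qed

text \<open>\<open>y\<close> is a subgradient of the conjugate at the slope \<open>f' y\<close>, hence its derivative there.\<close>

lemma deriv_conjugate_gradient:
  assumes f: "legendre f" and g: "legendre (conjugate f)" and y: "y \<in> interior (eff_dom f)"
    and x: "deriv (fin f) y \<in> interior (eff_dom (conjugate f))"
  shows "deriv (fin (conjugate f)) (deriv (fin f) y) = y"
proof -
  define x where "x = deriv (fin f) y"
  have P: "proper_fun f" using f unfolding legendre_def by blast
  have "((\<lambda>z. fin (conjugate f) z - y * z) has_real_derivative
      deriv (fin (conjugate f)) x - y) (at x)"
    using legendre_has_deriv[OF g x] unfolding x_def by (auto intro!: derivative_eq_intros)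
  moreover obtain e where e: "e > 0" "ball x e \<subseteq> eff_dom (conjugate f)"
    using x unfolding x_def by (meson mem_interior)
  note e(1)
  moreover have "\<forall>z. \<bar>x - z\<bar> < e \<longrightarrow>
      fin (conjugate f) x - y * x \<le> fin (conjugate f) z - y * z"
  proof (intro allI impI)
    fix z assume "\<bar>x - z\<bar> < e"
    then have "z \<in> eff_dom (conjugate f)" using e(2) by (auto simp: dist_real_def)
    then have "z * y \<le> fin f y + fin (conjugate f) z"
      using fenchel_young[OF P] y interior_subset unfolding eff_dom_def by blast
    then show "fin (conjugate f) x - y * x \<le> fin (conjugate f) z - y * z"
      using gradient_in_dom(2)[OF f y] unfolding x_def by (simp add: algebra_simps)
  qed
  ultimately have "deriv (fin (conjugate f)) x - y = 0" by (rule DERIV_local_min)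
  then show ?thesis unfolding x_def by simp
qed

text \<open>Strictly increasing slopes put \<open>f' y\<close> strictly between two slopes, which lie in the convex
  dual domain.\<close>

lemma gradient_in_interior:
  assumes f: "legendre f" and g: "legendre (conjugate f)"
    and C2: "C_on 2 (interior (eff_dom f)) (fin f)"
    and pos: "\<And>t. t \<in> interior (eff_dom f) \<Longrightarrow> 0 < (deriv ^^ 2) (fin f) t"
    and y: "y \<in> interior (eff_dom f)"
  shows "deriv (fin f) y \<in> interior (eff_dom (conjugate f))"
proof -
  let ?D = "deriv (fin f)"
  obtain e where e: "e > 0" "cball y e \<subseteq> interior (eff_dom f)"
    using y open_interior open_contains_cball by blast
  have inc: "?D s < ?D t" if "s < t" "s \<in> cball y e" "t \<in> cball y e" for s t
  proof (rule DERIV_pos_imp_increasing[OF that(1)])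
    fix u assume "s \<le> u" "u \<le> t"
    then have "u \<in> cball y e" using that(2,3) by (auto simp: dist_real_def)
    then show "\<exists>D. (?D has_real_derivative D) (at u) \<and> 0 < D"
      using e(2) C_on_2D(2)[OF C2] pos by blast
  qed
  have m: "y - e \<in> cball y e" "y \<in> cball y e" "y + e \<in> cball y e"
    using e(1) by (auto simp: dist_real_def)
  have "?D (y - e) < ?D y" "?D y < ?D (y + e)" using inc m e(1) by auto
  moreover have "{?D (y - e)..?D (y + e)} \<subseteq> eff_dom (conjugate f)"
  proof -
    have "?D (y - e) \<in> eff_dom (conjugate f)" "?D (y + e) \<in> eff_dom (conjugate f)"
      using gradient_in_dom(1)[OF f] m e(2) by blast+
    moreover have "is_interval (eff_dom (conjugate f))"
      using legendre_convex_dom[OF g] by (simp add: is_interval_convex_1)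
    ultimately show ?thesis
      by (intro subsetI, elim atLeastAtMost_iff[THEN iffD1, THEN conjE])
        (rule mem_is_interval_1_I)
  qed
  ultimately show ?thesis
    by (intro interiorI[of "{?D (y - e)<..<?D (y + e)}"]) auto
qed

text \<open>Differentiate \<open>g' (f' t) = t\<close>, where \<open>g\<close> is the conjugate of \<open>f\<close>.\<close>

lemma second_deriv_conjugate:
  assumes f: "legendre f" and g: "legendre (conjugate f)"
    and C2: "C_on 2 (interior (eff_dom f)) (fin f)"
    and D2: "C_on 2 (interior (eff_dom (conjugate f))) (fin (conjugate f))"
    and pos: "\<And>t. t \<in> interior (eff_dom f) \<Longrightarrow> 0 < (deriv ^^ 2) (fin f) t"
    and y: "y \<in> interior (eff_dom f)"
  shows "(deriv ^^ 2) (fin (conjugate f)) (deriv (fin f) y) = 1 / (deriv ^^ 2) (fin f) y"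
proof -
  let ?g = "fin (conjugate f)"
  have int: "deriv (fin f) t \<in> interior (eff_dom (conjugate f))" if "t \<in> interior (eff_dom f)" for t
    using gradient_in_interior[OF f g C2] pos that by blast
  have "((\<lambda>t. deriv ?g (deriv (fin f) t)) has_real_derivative
      (deriv ^^ 2) ?g (deriv (fin f) y) * (deriv ^^ 2) (fin f) y) (at y)"
    by (rule DERIV_chain2[OF C_on_2D(2)[OF D2 int[OF y]] C_on_2D(2)[OF C2 y]])
  then have "((\<lambda>t. t) has_real_derivative
      (deriv ^^ 2) ?g (deriv (fin f) y) * (deriv ^^ 2) (fin f) y) (at y)"
    by (rule has_field_derivative_transform_within_open[OF _ open_interior y])
      (rule deriv_conjugate_gradient[OF f g _ int])
  then have "(deriv ^^ 2) ?g (deriv (fin f) y) * (deriv ^^ 2) (fin f) y = 1"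
    using DERIV_ident DERIV_unique by blast
  then show ?thesis using pos[OF y] by (simp add: field_simps)
qed

section \<open>The Bregman divergence as an integral remainder\<close>

lemma bregman_nonneg:
  assumes "legendre f" "y \<in> interior (eff_dom f)" "x \<in> eff_dom f"
  shows "0 \<le> bregman f x y"
  using legendre_tangent[OF assms] unfolding bregman_def by (simp add: algebra_simps)

text \<open>The base point \<open>b\<close> may lie on the boundary. The monotone slopes give
  \<open>0 \<le> bregman f b x \<le> f b - f x - (b - x) * f' y\<close> for \<open>x\<close> between \<open>y\<close> and \<open>b\<close>, and by lower
  semicontinuity the right-hand side is eventually below every positive number.\<close>

lemma bregman_tendsto_0:
  assumes f: "legendre f" and b: "b \<in> eff_dom f" and y: "y \<in> interior (eff_dom f)"
    and F: "F \<le> at b" "\<forall>\<^sub>F x in F. x \<in> interior (eff_dom f) \<and> (y \<le> x \<and> x \<le> b \<or> b \<le> x \<and> x \<le> y)"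
  shows "((\<lambda>x. bregman f b x) \<longlongrightarrow> 0) F"
proof (rule tendstoI)
  fix e :: real assume e: "e > 0"
  define D where "D = deriv (fin f) y"
  have P: "proper_fun f" and lsc: "lsc_fun f" using f unfolding legendre_def by blast+
  have "ereal (fin f b) \<le> Liminf (at b) f"
    using lsc eff_dom_finite[OF P b] unfolding lsc_fun_def by metis
  moreover have "ereal (fin f b - e / 2) < ereal (fin f b)" using e by simp
  ultimately have "\<forall>\<^sub>F x in at b. ereal (fin f b - e / 2) < f x"
    by (simp add: le_Liminf_iff)
  then have "\<forall>\<^sub>F x in F. ereal (fin f b - e / 2) < f x" by (rule filter_leD[OF F(1)])
  moreover have "((\<lambda>x. (b - x) * D) \<longlongrightarrow> (b - b) * D) (at b)" by (intro tendsto_intros)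
  then have "((\<lambda>x. (b - x) * D) \<longlongrightarrow> 0) F" using F(1) tendsto_mono by force
  then have "\<forall>\<^sub>F x in F. dist ((b - x) * D) 0 < e / 2" by (rule tendstoD) (use e in simp)
  ultimately show "\<forall>\<^sub>F x in F. dist (bregman f b x) 0 < e" using F(2)
  proof eventually_elim
    case (elim x)
    have x: "x \<in> interior (eff_dom f)" using elim by blast
    then have "f x = ereal (fin f x)" using interior_subset eff_dom_finite[OF P] by blast
    then have 1: "fin f b - e / 2 < fin f x" using elim(1) by simp
    have 2: "(b - x) * D \<le> (b - x) * deriv (fin f) x"
    proof (cases "y \<le> x \<and> x \<le> b")
      case True
      then show ?thesis
        using legendre_deriv_mono[OF f y x] unfolding D_def by (intro mult_left_mono) auto
    next
      case False
      then have "b \<le> x" "x \<le> y" using elim(3) by auto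
      then show ?thesis
        using legendre_deriv_mono[OF f x y] unfolding D_def by (intro mult_left_mono_neg) auto
    qed
    have "\<bar>(b - x) * D\<bar> < e / 2" using elim(2) by simp
    then have "bregman f b x < e" using 1 2 unfolding bregman_def by linarith
    then show ?case using bregman_nonneg[OF f x b] by simp
  qed
qed

lemma between_in_interior_dom:
  assumes f: "legendre f" and b: "b \<in> eff_dom f" and y: "y \<in> interior (eff_dom f)"
    and x: "y \<le> x \<and> x < b \<or> b < x \<and> x \<le> y"
  shows "x \<in> interior (eff_dom f)"
proof -
  define t where "t = (b - x) / (b - y)"
  have "0 < t" "t \<le> 1" and [simp]: "b \<noteq> y" using x unfolding t_def by (auto simp: field_simps)
  moreover have "b - t * (b - y) = x" unfolding t_def by simp
  ultimately show ?thesis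
    using mem_interior_closure_convex_shrink[OF legendre_convex_dom[OF f] y, of b t] b closure_subset
    by auto
qed

text \<open>As a function of its second argument, \<open>bregman f b\<close> has derivative \<open>- (b - x) * f'' x\<close>, and
  its limit at \<open>b\<close> is \<open>0\<close>. The integral may be improper at \<open>b\<close>; the integrand has constant sign, so
  the fundamental theorem of calculus applies on the open interval.\<close>

lemma bregman_eq_integral:
  assumes f: "legendre f" and C2: "C_on 2 (interior (eff_dom f)) (fin f)"
    and b: "b \<in> eff_dom f" and y: "y \<in> interior (eff_dom f)"
  shows "(LBINT x=y..b. (b - x) * (deriv ^^ 2) (fin f) x) = bregman f b y"
proof -
  let ?S = "interior (eff_dom f)" and ?h = "(deriv ^^ 2) (fin f)"
  have h0: "0 \<le> ?h x" if "x \<in> ?S" for x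
    using legendre_second_deriv_nonneg[OF f C2 that] .
  have ch: "isCont ?h x" if "x \<in> ?S" for x
    using C_on_2_continuous[OF C2] that continuous_on_eq_continuous_at[OF open_interior] by blast
  have dB: "((\<lambda>x. bregman f b x) has_real_derivative - ((b - x) * ?h x)) (at x)" if "x \<in> ?S" for x
    unfolding bregman_def
    using C_on_2D[OF C2 that] by (auto intro!: derivative_eq_intros)
  then have cB: "((\<lambda>x. bregman f b x) \<longlongrightarrow> bregman f b y) (at y)"
    using y by (meson DERIV_isCont isCont_def)
  note seg = between_in_interior_dom[OF f b y]
  show ?thesis
  proof (cases y b rule: linorder_cases)
    case less
    have "(LBINT x=ereal y..ereal b. (b - x) * ?h x) = 0 - (- bregman f b y)"
    proof (rule interval_integral_FTC_nonneg(2)[where F = "\<lambda>x. - bregman f b x"])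
      show "ereal y < ereal b" using less by simp
      fix x assume "ereal y < ereal x" "ereal x < ereal b"
      then have x: "x \<in> ?S" using seg by simp
      show "((\<lambda>x. - bregman f b x) has_real_derivative (b - x) * ?h x) (at x)"
        using DERIV_minus[OF dB[OF x]] by simp
      show "isCont (\<lambda>x. (b - x) * ?h x) x"
        using ch[OF x] by (intro continuous_intros)
    next
      show "AE x in lborel. ereal y < ereal x \<longrightarrow> ereal x < ereal b \<longrightarrow> 0 \<le> (b - x) * ?h x"
        using h0 seg by (intro AE_I2) simp
      have "((\<lambda>x. - bregman f b x) \<longlongrightarrow> - bregman f b y) (at_right y)"
        using cB by (intro tendsto_minus) (rule tendsto_mono[OF at_le], auto)
      then show "(((\<lambda>x. - bregman f b x) \<circ> real_of_ereal) \<longlongrightarrow> - bregman f b y) (at_right (ereal y))"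
        by (simp only: ereal_tendsto_simps1)
      have "((\<lambda>x. bregman f b x) \<longlongrightarrow> 0) (at_left b)"
      proof (rule bregman_tendsto_0[OF f b y])
        show "at_left b \<le> at b" by (rule at_le) simp
        have "\<forall>\<^sub>F x in at_left b. x \<in> {y<..<b}" using less by (rule eventually_at_left_real)
        then show "\<forall>\<^sub>F x in at_left b. x \<in> ?S \<and> (y \<le> x \<and> x \<le> b \<or> b \<le> x \<and> x \<le> y)"
          by eventually_elim (use seg in auto)
      qed
      then have "((\<lambda>x. - bregman f b x) \<longlongrightarrow> - 0) (at_left b)" by (rule tendsto_minus)
      then show "(((\<lambda>x. - bregman f b x) \<circ> real_of_ereal) \<longlongrightarrow> 0) (at_left (ereal b))"
        by (simp only: ereal_tendsto_simps1 minus_zero)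
    qed
    then show ?thesis by simp
  next
    case equal
    then show ?thesis unfolding bregman_def by simp
  next
    case greater
    have "(LBINT x=ereal b..ereal y. - ((b - x) * ?h x)) = bregman f b y - 0"
    proof (rule interval_integral_FTC_nonneg(2)[where F = "\<lambda>x. bregman f b x"])
      show "ereal b < ereal y" using greater by simp
      fix x assume "ereal b < ereal x" "ereal x < ereal y"
      then have x: "x \<in> ?S" using seg by simp
      show "((\<lambda>x. bregman f b x) has_real_derivative - ((b - x) * ?h x)) (at x)"
        using dB[OF x] .
      show "isCont (\<lambda>x. - ((b - x) * ?h x)) x"
        using ch[OF x] by (intro continuous_intros)
    next
      show "AE x in lborel. ereal b < ereal x \<longrightarrow> ereal x < ereal y \<longrightarrow> 0 \<le> - ((b - x) * ?h x)"
        using h0 seg by (intro AE_I2) (simp add: mult_nonpos_nonneg)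
      have "((\<lambda>x. bregman f b x) \<longlongrightarrow> bregman f b y) (at_left y)"
        using cB by (rule tendsto_mono[OF at_le, rotated]) auto
      then show "(((\<lambda>x. bregman f b x) \<circ> real_of_ereal) \<longlongrightarrow> bregman f b y) (at_left (ereal y))"
        by (simp only: ereal_tendsto_simps1)
      have "((\<lambda>x. bregman f b x) \<longlongrightarrow> 0) (at_right b)"
      proof (rule bregman_tendsto_0[OF f b y])
        show "at_right b \<le> at b" by (rule at_le) simp
        have "\<forall>\<^sub>F x in at_right b. x \<in> {b<..<y}" using greater by (rule eventually_at_right_real)
        then show "\<forall>\<^sub>F x in at_right b. x \<in> ?S \<and> (y \<le> x \<and> x \<le> b \<or> b \<le> x \<and> x \<le> y)"
          by eventually_elim (use seg in auto)
      qed
      then show "(((\<lambda>x. bregman f b x) \<circ> real_of_ereal) \<longlongrightarrow> 0) (at_right (ereal b))"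
        by (simp only: ereal_tendsto_simps1)
    qed
    then show ?thesis
      by (subst interval_integral_endpoints_reverse) (simp add: interval_lebesgue_integral_uminus)
  qed
qed

section \<open>Legendre functions are closed under scaling and affine perturbation\<close>

text \<open>The Bregman divergence from a fixed point is of this form in its first argument, so its
  multiples are admissible as exponents of log-concave densities.\<close>

lemma legendre_scale_add_affine:
  fixes a c d :: real
  assumes g: "legendre g" and a: "a > 0"
  defines "f \<equiv> \<lambda>x. ereal a * g x + ereal (c + d * x)"
  shows "legendre f" and "eff_dom f = eff_dom g"
    and "\<And>x. x \<in> eff_dom g \<Longrightarrow> fin f x = a * fin g x + (c + d * x)"
proof -
  have P: "proper_fun g" and lsc: "lsc_fun g" and cg: "convex_on (eff_dom g) (fin g)"
    and ne: "interior (eff_dom g) \<noteq> {}" and C1: "C_on 1 (interior (eff_dom g)) (fin g)"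
    and sc: "strictly_convex_on (interior (eff_dom g)) (fin g)" and st: "steep g"
    using g unfolding legendre_def by blast+
  let ?S = "interior (eff_dom g)"
  have gx: "g x = ereal (fin g x)" if "x \<in> eff_dom g" for x
    using eff_dom_finite[OF P that] .
  show dom: "eff_dom f = eff_dom g"
  proof (rule set_eqI)
    fix x show "x \<in> eff_dom f \<longleftrightarrow> x \<in> eff_dom g"
      using a by (cases "g x") (auto simp: f_def eff_dom_def)
  qed
  show fin: "fin f x = a * fin g x + (c + d * x)" if "x \<in> eff_dom g" for x
  proof -
    have "f x = ereal (a * fin g x + (c + d * x))"
      unfolding f_def by (subst gx[OF that]) simp
    then show ?thesis unfolding fin_def[of f] by simp
  qed
  have finS: "fin f x = a * fin g x + (c + d * x)" if "x \<in> ?S" for x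
    using fin that interior_subset by blast
  have D: "(fin f has_real_derivative a * deriv (fin g) x + d) (at x)" if x: "x \<in> ?S" for x
  proof (rule has_field_derivative_transform_within_open[OF _ open_interior x])
    show "((\<lambda>x. a * fin g x + (c + d * x)) has_real_derivative a * deriv (fin g) x + d) (at x)"
      using legendre_has_deriv[OF g x] by (auto intro!: derivative_eq_intros)
  qed (simp add: finS)
  have "proper_fun f"
    using P a unfolding proper_fun_def dom
  proof (intro conjI allI)
    fix x assume "eff_dom g \<noteq> {} \<and> (\<forall>x. g x \<noteq> - \<infinity>)"
    then show "f x \<noteq> - \<infinity>" using a unfolding f_def by (cases "g x") auto
  qed auto
  moreover have "lsc_fun f"
    unfolding lsc_fun_def le_Liminf_iff
  proof (intro allI impI)
    fix x y assume "y < f x"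
    then obtain r where r: "y < ereal r" "ereal r < f x" using ereal_dense2 by blast
    have "ereal ((r - (c + d * x)) / a) < g x"
      using r(2) a unfolding f_def by (cases "g x") (auto simp: field_simps)
    then obtain s where s: "(r - (c + d * x)) / a < s" "ereal s < g x"
      using ereal_dense2 by fastforce
    have "((\<lambda>z. (r - (c + d * z)) / a) \<longlongrightarrow> (r - (c + d * x)) / a) (at x)"
      using a by (intro tendsto_intros) auto
    then have "\<forall>\<^sub>F z in at x. (r - (c + d * z)) / a < s"
      using s(1) by (rule order_tendstoD(2))
    moreover have "\<forall>\<^sub>F z in at x. ereal s < g z"
      using lsc s(2) unfolding lsc_fun_def le_Liminf_iff by blast
    ultimately show "\<forall>\<^sub>F z in at x. y < f z"
    proof eventually_elim
      case (elim z)
      have "ereal r < f z"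
        using elim a unfolding f_def
        by (cases "g z") (auto simp: field_simps intro: order.strict_trans dest: mult_strict_left_mono)
      then show ?case using r(1) by (rule order.strict_trans[rotated])
    qed
  qed
  moreover have "convex_on (eff_dom f) (fin f)"
    unfolding dom
  proof (rule convex_onI)
    fix t x y :: real assume *: "t > 0" "t < 1" "x \<in> eff_dom g" "y \<in> eff_dom g"
    have m: "(1 - t) *\<^sub>R x + t *\<^sub>R y \<in> eff_dom g"
      using legendre_convex_dom[OF g] * by (intro convexD) auto
    have "fin g ((1 - t) *\<^sub>R x + t *\<^sub>R y) \<le> (1 - t) * fin g x + t * fin g y"
      using cg * by (intro convex_onD) auto
    from mult_left_mono[OF this, of a] a
    show "fin f ((1 - t) *\<^sub>R x + t *\<^sub>R y) \<le> (1 - t) * fin f x + t * fin f y"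
      unfolding fin[OF m] fin[OF *(3)] fin[OF *(4)] by (simp add: algebra_simps)
  qed (rule legendre_convex_dom[OF g])
  moreover have "C_on 1 ?S (fin f)"
  proof (rule C_on_1I[OF open_interior D])
    have "continuous_on ?S ((deriv ^^ 1) (fin g))" using C1 unfolding C_on_def by blast
    then show "continuous_on ?S (\<lambda>x. a * deriv (fin g) x + d)"
      by (intro continuous_intros) simp
  qed
  moreover have "strictly_convex_on ?S (fin f)"
    unfolding strictly_convex_on_def
  proof (intro conjI ballI allI impI)
    show cS: "convex ?S" using sc unfolding strictly_convex_on_def by blast
    fix x y u :: real assume *: "x \<in> ?S" "y \<in> ?S" "x \<noteq> y" "0 < u" "u < 1"
    have m: "(1 - u) * x + u * y \<in> ?S"
      using convexD[OF cS *(1,2), of "1 - u" u] *(4,5) by simp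
    have "fin g ((1 - u) * x + u * y) < (1 - u) * fin g x + u * fin g y"
      using sc * unfolding strictly_convex_on_def by blast
    from mult_strict_left_mono[OF this a]
    show "fin f ((1 - u) * x + u * y) < (1 - u) * fin f x + u * fin f y"
      unfolding finS[OF m] finS[OF *(1)] finS[OF *(2)] by (simp add: algebra_simps)
  qed
  moreover have "steep f"
    unfolding steep_def dom
  proof (intro ballI)
    fix x y assume x: "x \<in> frontier (eff_dom g)" and y: "y \<in> ?S"
    have lim: "filterlim (\<lambda>t. deriv (fin g) (x + t * (y - x)) * (y - x)) at_bot (at_right 0)"
      using st x y unfolding steep_def by blast
    show "filterlim (\<lambda>t. deriv (fin f) (x + t * (y - x)) * (y - x)) at_bot (at_right 0)"
      unfolding filterlim_at_bot
    proof
      fix Z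
      have "\<forall>\<^sub>F t in at_right 0.
          deriv (fin g) (x + t * (y - x)) * (y - x) \<le> (Z - d * (y - x)) / a"
        using lim unfolding filterlim_at_bot by blast
      moreover have "\<forall>\<^sub>F t in at_right (0::real). 0 < t \<and> t \<le> 1"
        unfolding eventually_at_right_field by (rule exI[of _ 1]) auto
      ultimately show "\<forall>\<^sub>F t in at_right 0. deriv (fin f) (x + t * (y - x)) * (y - x) \<le> Z"
      proof eventually_elim
        case (elim t)
        have "x + t * (y - x) \<in> ?S"
          using mem_interior_closure_convex_shrink[OF legendre_convex_dom[OF g] y, of x t] x elim(2)
          unfolding frontier_def by (simp add: algebra_simps)
        from DERIV_imp_deriv[OF D[OF this]] show ?case
          using elim(1) a by (simp add: field_simps)
      qed
    qed
  qed
  ultimately show "legendre f" using ne unfolding legendre_def dom by blast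
qed

section \<open>Moments from exponential integrals\<close>

lemma exp_abs_le_sum: "exp (x * b) * exp (d * \<bar>b\<bar>) \<le> exp ((x + d) * b) + exp ((x - d) * b)"
  for x b d :: real
proof (cases "b \<ge> 0")
  case True
  then have "exp (x * b) * exp (d * \<bar>b\<bar>) = exp ((x + d) * b)"
    by (simp add: exp_add[symmetric] algebra_simps)
  then show ?thesis by simp
next
  case False
  then have "exp (x * b) * exp (d * \<bar>b\<bar>) = exp ((x - d) * b)"
    by (simp add: exp_add[symmetric] algebra_simps)
  then show ?thesis by simp
qed

text \<open>A factor \<open>b\<^sup>2\<close> is absorbed by \<open>exp (d * \<bar>b\<bar>)\<close>, that is, by moving the exponent by \<open>d\<close>.\<close>

lemma sq_exp_le:
  assumes "d > (0::real)"
  shows "b\<^sup>2 * exp (x * b) \<le> (2 / d\<^sup>2) * (exp ((x + d) * b) + exp ((x - d) * b))"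
proof -
  have "1 + d * \<bar>b\<bar> + (d * \<bar>b\<bar>)\<^sup>2 / 2 \<le> exp (d * \<bar>b\<bar>)"
    using assms by (intro exp_lower_Taylor_quadratic) simp
  then have "(d * \<bar>b\<bar>)\<^sup>2 / 2 \<le> exp (d * \<bar>b\<bar>)"
    using assms by (smt (verit) mult_nonneg_nonneg abs_ge_zero)
  then have "b\<^sup>2 \<le> (2 / d\<^sup>2) * exp (d * \<bar>b\<bar>)"
    using assms by (simp add: power_mult_distrib field_simps)
  then have "b\<^sup>2 * exp (x * b) \<le> (2 / d\<^sup>2) * exp (d * \<bar>b\<bar>) * exp (x * b)"
    by (rule mult_right_mono) simp
  also have "\<dots> = (2 / d\<^sup>2) * (exp (x * b) * exp (d * \<bar>b\<bar>))" by simp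
  also have "\<dots> \<le> (2 / d\<^sup>2) * (exp ((x + d) * b) + exp ((x - d) * b))"
    by (intro mult_left_mono exp_abs_le_sum) simp
  finally show ?thesis .
qed

lemma abs_exp_minus_1_le: "\<bar>exp y - 1\<bar> \<le> \<bar>y\<bar> * exp \<bar>y\<bar>" for y :: real
proof (cases "y \<ge> 0")
  case True
  have "(1 - y) * exp y \<le> exp (- y) * exp y"
    using exp_ge_add_one_self[of "- y"] by (intro mult_right_mono) auto
  then have "exp y - 1 \<le> y * exp y" by (simp add: exp_minus_inverse algebra_simps mult.commute)
  then show ?thesis using True by simp
next
  case False
  have "1 + y \<le> exp y" by (rule exp_ge_add_one_self)
  moreover have "\<bar>y\<bar> * 1 \<le> \<bar>y\<bar> * exp \<bar>y\<bar>" by (intro mult_left_mono) auto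
  moreover have "\<bar>exp y - 1\<bar> = 1 - exp y" "\<bar>y\<bar> = - y" using False by auto
  ultimately show ?thesis by linarith
qed

context
  fixes M :: "real measure" and e :: real
  assumes id_meas: "(\<lambda>b. b) \<in> borel_measurable M"
    and exp_int: "\<And>x. \<bar>x\<bar> < e \<Longrightarrow> integrable M (\<lambda>b. exp (x * b))"
begin

lemma integrable_sq_exp:
  assumes x: "\<bar>x\<bar> < e"
  shows "integrable M (\<lambda>b. b\<^sup>2 * exp (x * b))"
proof -
  note [measurable] = id_meas
  define d where "d = (e - \<bar>x\<bar>) / 2"
  have d: "d > 0" "\<bar>x + d\<bar> < e" "\<bar>x - d\<bar> < e" using x unfolding d_def by (auto simp: field_simps)
  show ?thesis
  proof (rule Bochner_Integration.integrable_bound)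
    show "integrable M (\<lambda>b. (2 / d\<^sup>2) * (exp ((x + d) * b) + exp ((x - d) * b)))"
      using exp_int d by auto
    show "AE b in M. norm (b\<^sup>2 * exp (x * b)) \<le> norm ((2 / d\<^sup>2) * (exp ((x + d) * b) + exp ((x - d) * b)))"
      using sq_exp_le[OF d(1), of _ x] by (intro AE_I2) (auto simp: abs_mult)
  qed measurable
qed

lemma integrable_id_exp:
  assumes x: "\<bar>x\<bar> < e"
  shows "integrable M (\<lambda>b. b * exp (x * b))"
proof (rule Bochner_Integration.integrable_bound)
  note [measurable] = id_meas
  show "(\<lambda>b. b * exp (x * b)) \<in> borel_measurable M" by measurable
  show "integrable M (\<lambda>b. b\<^sup>2 * exp (x * b) + exp (x * b))"
    using integrable_sq_exp exp_int x by auto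
  show "AE b in M. norm (b * exp (x * b)) \<le> norm (b\<^sup>2 * exp (x * b) + exp (x * b))"
  proof (intro AE_I2)
    fix b :: real
    \<comment> \<open>The square expands to \<open>b\<^sup>2 - \<bar>b\<bar> + 1/4\<close>.\<close>
    have "0 \<le> (\<bar>b\<bar> - 1/2)\<^sup>2" by simp
    then have "\<bar>b\<bar> \<le> b\<^sup>2 + 1" by (simp add: power2_eq_square algebra_simps abs_mult_self_eq)
    then have "\<bar>b\<bar> * exp (x * b) \<le> (b\<^sup>2 + 1) * exp (x * b)" by (rule mult_right_mono) simp
    then show "norm (b * exp (x * b)) \<le> norm (b\<^sup>2 * exp (x * b) + exp (x * b))"
      by (simp add: abs_mult algebra_simps)
  qed
qed

text \<open>Integrating the tangent inequality for \<open>exp\<close> shows that the integral of \<open>b * exp (x * b)\<close> is a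
  subgradient of the moment generating function at \<open>x\<close>. Where the derivative is known to exist, it
  is therefore this integral, and no exchange of limits is needed.\<close>

lemma integral_id_exp:
  assumes x: "\<bar>x\<bar> < e"
    and D: "((\<lambda>x. \<integral>b. exp (x * b) \<partial>M) has_real_derivative D) (at x)"
  shows "(\<integral>b. b * exp (x * b) \<partial>M) = D"
proof -
  define I where "I = (\<integral>b. b * exp (x * b) \<partial>M)"
  have "((\<lambda>y. (\<integral>b. exp (y * b) \<partial>M) - y * I) has_real_derivative D - I) (at x)"
    using D by (auto intro!: derivative_eq_intros)
  moreover have "0 < e - \<bar>x\<bar>" using x by simp
  moreover have "\<forall>y. \<bar>x - y\<bar> < e - \<bar>x\<bar> \<longrightarrow>
      (\<integral>b. exp (x * b) \<partial>M) - x * I \<le> (\<integral>b. exp (y * b) \<partial>M) - y * I"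
  proof (intro allI impI)
    fix y assume "\<bar>x - y\<bar> < e - \<bar>x\<bar>"
    then have y: "\<bar>y\<bar> < e" by linarith
    have "(\<integral>b. exp (x * b) \<partial>M) + (y - x) * I = (\<integral>b. exp (x * b) + (y - x) * (b * exp (x * b)) \<partial>M)"
      unfolding I_def using exp_int[OF x] integrable_id_exp[OF x] by simp
    also have "\<dots> \<le> (\<integral>b. exp (y * b) \<partial>M)"
    proof (rule integral_mono)
      fix b :: real
      have "(1 + (y - x) * b) * exp (x * b) \<le> exp ((y - x) * b) * exp (x * b)"
        by (intro mult_right_mono exp_ge_add_one_self) simp
      then show "exp (x * b) + (y - x) * (b * exp (x * b)) \<le> exp (y * b)"
        by (simp add: exp_add[symmetric] algebra_simps)
    qed (use exp_int[OF x] integrable_id_exp[OF x] exp_int[OF y] in auto)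
    finally show "(\<integral>b. exp (x * b) \<partial>M) - x * I \<le> (\<integral>b. exp (y * b) \<partial>M) - y * I"
      by (simp add: algebra_simps)
  qed
  ultimately have "D - I = 0" by (rule DERIV_local_min)
  then show ?thesis unfolding I_def by simp
qed

text \<open>The difference quotients \<open>b * (exp (x * b) - 1) / x\<close> tend to \<open>b\<^sup>2\<close>. They need not lie on one side
  of their limit, so here dominated convergence takes the place of the subgradient argument.\<close>

lemma integral_sq:
  assumes e: "e > 0"
    and D: "((\<lambda>x. \<integral>b. b * exp (x * b) \<partial>M) has_real_derivative D) (at 0)"
  shows "(\<integral>b. b\<^sup>2 \<partial>M) = D"
proof -
  note [measurable] = id_meas
  \<comment> \<open>\<open>b\<^sup>2 * exp (d * \<bar>b\<bar>)\<close> dominates as soon as \<open>X n \<le> d\<close>, and it is integrable for every \<open>d < e\<close>.\<close>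
  define d where "d = e / 2"
  define X where "X n = d / real (Suc n)" for n
  have d: "d > 0" "\<bar>d\<bar> < e" using e unfolding d_def by auto
  have X: "0 < X n" "X n \<le> d" "\<bar>X n\<bar> < e" for n
  proof -
    show 1: "0 < X n" unfolding X_def using d by simp
    show 2: "X n \<le> d" unfolding X_def using d by (simp add: field_simps)
    show "\<bar>X n\<bar> < e" using 1 2 d by linarith
  qed
  have X0: "X \<longlonglongrightarrow> 0"
    unfolding X_def using LIMSEQ_Suc[OF lim_const_over_n[of d]] by simp
  then have X0': "filterlim X (at 0) sequentially"
    using X(1) by (auto simp: filterlim_at order_less_imp_not_eq2)
  have quot: "(\<lambda>n. (g (0 + X n) - g 0) / X n) \<longlonglongrightarrow> G"
    if "(g has_real_derivative G) (at 0)" for g :: "real \<Rightarrow> real" and G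
    using filterlim_compose[OF that[unfolded DERIV_def] X0'] .
  have "(\<lambda>n. \<integral>b. b * ((exp (X n * b) - 1) / X n) \<partial>M) \<longlonglongrightarrow> (\<integral>b. b\<^sup>2 \<partial>M)"
  proof (rule integral_dominated_convergence)
    show "integrable M (\<lambda>b. b\<^sup>2 * exp (d * b) + b\<^sup>2 * exp (- d * b))"
      using integrable_sq_exp[of d] integrable_sq_exp[of "- d"] d by simp
    show "AE b in M. (\<lambda>n. b * ((exp (X n * b) - 1) / X n)) \<longlonglongrightarrow> b\<^sup>2"
    proof (intro AE_I2)
      fix b :: real
      have "((\<lambda>x. exp (x * b)) has_real_derivative b) (at 0)"
        by (auto intro!: derivative_eq_intros)
      from tendsto_mult[OF tendsto_const quot[OF this], of b]
      show "(\<lambda>n. b * ((exp (X n * b) - 1) / X n)) \<longlonglongrightarrow> b\<^sup>2"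
        by (simp add: power2_eq_square)
    qed
    show "AE b in M. norm (b * ((exp (X n * b) - 1) / X n)) \<le> b\<^sup>2 * exp (d * b) + b\<^sup>2 * exp (- d * b)"
      for n
    proof (intro AE_I2)
      fix b :: real
      have "\<bar>exp (X n * b) - 1\<bar> \<le> \<bar>X n * b\<bar> * exp \<bar>X n * b\<bar>" by (rule abs_exp_minus_1_le)
      also have "\<dots> \<le> \<bar>X n * b\<bar> * exp (d * \<bar>b\<bar>)"
        using X(1,2)[of n] by (intro mult_left_mono) (auto simp: abs_mult intro!: mult_right_mono)
      finally have "\<bar>exp (X n * b) - 1\<bar> / X n \<le> \<bar>b\<bar> * exp (d * \<bar>b\<bar>)"
        using X(1)[of n] by (simp add: field_simps abs_mult)
      then have "\<bar>b\<bar> * (\<bar>exp (X n * b) - 1\<bar> / X n) \<le> \<bar>b\<bar> * (\<bar>b\<bar> * exp (d * \<bar>b\<bar>))"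
        by (rule mult_left_mono) simp
      also have "\<dots> = b\<^sup>2 * (exp (0 * b) * exp (d * \<bar>b\<bar>))"
        by (simp add: power2_eq_square)
      also have "\<dots> \<le> b\<^sup>2 * (exp ((0 + d) * b) + exp ((0 - d) * b))"
        by (intro mult_left_mono exp_abs_le_sum) simp
      also have "\<bar>b\<bar> * (\<bar>exp (X n * b) - 1\<bar> / X n) = norm (b * ((exp (X n * b) - 1) / X n))"
        using X(1)[of n] by (simp add: abs_mult)
      finally show "norm (b * ((exp (X n * b) - 1) / X n)) \<le> b\<^sup>2 * exp (d * b) + b\<^sup>2 * exp (- d * b)"
        by (simp add: algebra_simps)
    qed
  qed measurable
  moreover have "(\<integral>b. b * ((exp (X n * b) - 1) / X n) \<partial>M) =
      ((\<integral>b. b * exp ((0 + X n) * b) \<partial>M) - (\<integral>b. b * exp (0 * b) \<partial>M)) / X n" for n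
  proof -
    have "(\<integral>b. b * ((exp (X n * b) - 1) / X n) \<partial>M) =
        (\<integral>b. (b * exp (X n * b) - b * exp (0 * b)) / X n \<partial>M)"
      by (simp add: algebra_simps diff_divide_distrib)
    also have "\<dots> = ((\<integral>b. b * exp (X n * b) \<partial>M) - (\<integral>b. b * exp (0 * b) \<partial>M)) / X n"
      using integrable_id_exp[OF X(3)[of n]] integrable_id_exp[of 0] e by simp
    finally show ?thesis by simp
  qed
  ultimately show ?thesis using quot[OF D] by (simp only: LIMSEQ_unique)
qed

end

section \<open>Exponential families\<close>

lemma borel_measurable_reference:
  assumes "reference_measure \<nu> \<B>" "f \<in> borel_measurable borel"
  shows "f \<in> borel_measurable \<nu>"
proof -
  have "f \<in> borel_measurable lborel" using assms(2) by simp
  then have "f \<in> borel_measurable lebesgue" by (rule measurable_completion)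
  then show ?thesis using assms(1) unfolding reference_measure_def by auto
qed

lemma integral_law:
  assumes nu: "reference_measure \<nu> \<B>" and p: "is_density \<nu> \<B> p"
    and f: "f \<in> borel_measurable borel"
  shows "integrable (law \<nu> \<B> p) f \<longleftrightarrow> set_integrable \<nu> \<B> (\<lambda>b. p b * f b)"
    and "(\<integral>b. f b \<partial>law \<nu> \<B> p) = (LINT b:\<B>|\<nu>. p b * f b)"
proof -
  have sp: "space \<nu> = UNIV" and B: "\<B> \<inter> space \<nu> \<in> sets \<nu>"
    using nu unfolding reference_measure_def by auto
  have "f \<in> borel_measurable \<nu>"
    using borel_measurable_reference[OF nu f] .
  then have f': "f \<in> borel_measurable (restrict_space \<nu> \<B>)"
    by (rule measurable_restrict_space1)
  have "set_integrable \<nu> \<B> p"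
    using p not_integrable_integral_eq unfolding is_density_def set_integrable_def
      set_lebesgue_integral_def by (metis zero_neq_one)
  then have p': "p \<in> borel_measurable (restrict_space \<nu> \<B>)"
    unfolding set_integrable_def borel_measurable_restrict_space_iff[OF B]
    by (rule borel_measurable_integrable)
  have nn: "AE b in restrict_space \<nu> \<B>. 0 \<le> p b"
    using p unfolding is_density_def by (intro AE_I2) (auto simp: space_restrict_space)
  show "integrable (law \<nu> \<B> p) f \<longleftrightarrow> set_integrable \<nu> \<B> (\<lambda>b. p b * f b)"
    unfolding law_def integrable_density[OF f' p' nn] integrable_restrict_space[OF B]
      set_integrable_def by simp
  show "(\<integral>b. f b \<partial>law \<nu> \<B> p) = (LINT b:\<B>|\<nu>. p b * f b)"
    unfolding law_def integral_density[OF f' p' nn] integral_restrict_space[OF B]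
      set_lebesgue_integral_def by simp
qed

text \<open>Exponential tilting moves one member of an exponential family to another one, so the
  normalization of the latter evaluates the moment generating function of the former.\<close>

lemma integral_exp_law:
  assumes nu: "reference_measure \<nu> \<B>" and p: "is_density \<nu> \<B> p" and q: "is_density \<nu> \<B> q"
    and tilt: "\<And>b. b \<in> \<B> \<Longrightarrow> p b * exp (x * b) = exp k * q b"
  shows "integrable (law \<nu> \<B> p) (\<lambda>b. exp (x * b))"
    and "(\<integral>b. exp (x * b) \<partial>law \<nu> \<B> p) = exp k"
proof -
  have m: "(\<lambda>b. exp (x * b)) \<in> borel_measurable borel" by measurable
  have eq: "indicator \<B> b *\<^sub>R (p b * exp (x * b)) = exp k * (indicator \<B> b *\<^sub>R q b)" for b
    using tilt[of b] by (auto simp: indicator_def)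
  have q1: "(\<integral>b. indicator \<B> b *\<^sub>R q b \<partial>\<nu>) = 1"
    using q unfolding is_density_def set_lebesgue_integral_def by blast
  then have "integrable \<nu> (\<lambda>b. indicator \<B> b *\<^sub>R q b)"
    using not_integrable_integral_eq by fastforce
  then show "integrable (law \<nu> \<B> p) (\<lambda>b. exp (x * b))"
    unfolding integral_law(1)[OF nu p m] set_integrable_def eq by (rule integrable_mult_right)
  show "(\<integral>b. exp (x * b) \<partial>law \<nu> \<B> p) = exp k"
    unfolding integral_law(2)[OF nu p m] set_lebesgue_integral_def eq using q1 by simp
qed

text \<open>Tilting gives the moment generating function \<open>m x = exp (K x)\<close> near \<open>0\<close>, with \<open>K\<close> twice
  continuously differentiable. The first two moments are \<open>m' 0 = K' 0\<close> and
  \<open>m'' 0 = (K' 0)\<^sup>2 + K'' 0\<close>, so the variance is \<open>K'' 0\<close>.\<close>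

lemma exponential_family_moments:
  assumes C2: "C_on 2 S (fin \<psi>)" and S: "open S" and s: "\<sigma>2 > 0" and \<theta>: "\<theta> \<in> S"
    and nu: "reference_measure \<nu> \<B>"
    and dens: "\<And>t. t \<in> S \<Longrightarrow> is_density \<nu> \<B> (p t)"
    and p: "\<And>t b. t \<in> S \<Longrightarrow> b \<in> \<B> \<Longrightarrow> p t b = exp ((b * t - fin \<psi> t) / \<sigma>2) * h b"
  shows "mean_is (law \<nu> \<B> (p \<theta>)) (deriv (fin \<psi>) \<theta>)"
    and "is_cgf_upto 2 (law \<nu> \<B> (p \<theta>)) (K_fun \<psi> \<theta> \<sigma>2)"
    and "variance_is (law \<nu> \<B> (p \<theta>)) (\<sigma>2 * (deriv ^^ 2) (fin \<psi>) \<theta>)"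
proof -
  let ?M = "law \<nu> \<B> (p \<theta>)" and ?K = "K_fun \<psi> \<theta> \<sigma>2"
  let ?K1 = "\<lambda>x. deriv (fin \<psi>) (\<theta> + x * \<sigma>2)" and ?K2 = "\<lambda>x. \<sigma>2 * (deriv ^^ 2) (fin \<psi>) (\<theta> + x * \<sigma>2)"
  obtain r where r: "r > 0" "ball \<theta> r \<subseteq> S" using S \<theta> open_contains_ball by blast
  define e where "e = r / \<sigma>2"
  have e: "e > 0" using r s unfolding e_def by simp
  have inS: "\<theta> + x * \<sigma>2 \<in> S" if "\<bar>x\<bar> < e" for x
  proof (rule subsetD[OF r(2)])
    have "\<bar>x\<bar> * \<sigma>2 < r" using that s unfolding e_def by (simp add: pos_less_divide_eq)
    then show "\<theta> + x * \<sigma>2 \<in> ball \<theta> r" using s by (simp add: dist_real_def abs_mult)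
  qed
  have tilt: "p \<theta> b * exp (x * b) = exp (?K x) * p (\<theta> + x * \<sigma>2) b" if "\<bar>x\<bar> < e" "b \<in> \<B>" for x b
  proof -
    have "(b * \<theta> - fin \<psi> \<theta>) / \<sigma>2 + x * b =
        ?K x + (b * (\<theta> + x * \<sigma>2) - fin \<psi> (\<theta> + x * \<sigma>2)) / \<sigma>2"
      using s unfolding K_fun_def by (simp add: field_simps)
    then have "exp ((b * \<theta> - fin \<psi> \<theta>) / \<sigma>2) * exp (x * b) =
        exp (?K x) * exp ((b * (\<theta> + x * \<sigma>2) - fin \<psi> (\<theta> + x * \<sigma>2)) / \<sigma>2)"
      by (simp only: exp_add[symmetric])
    then show ?thesis
      unfolding p[OF \<theta> that(2)] p[OF inS[OF that(1)] that(2)] by simp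
  qed
  have int: "integrable ?M (\<lambda>b. exp (x * b))" and mgf: "(\<integral>b. exp (x * b) \<partial>?M) = exp (?K x)"
    if "\<bar>x\<bar> < e" for x
    using integral_exp_law[OF nu dens[OF \<theta>] dens[OF inS[OF that]] tilt[OF that]] by blast+
  have cgf: "cgf ?M x = ?K x" if "\<bar>x\<bar> < e" for x
    unfolding cgf_def mgf[OF that] by simp
  have ball: "x \<in> ball 0 e \<longleftrightarrow> \<bar>x\<bar> < e" for x by (simp add: dist_real_def)
  have aff: "((\<lambda>x. \<theta> + x * \<sigma>2) has_real_derivative \<sigma>2) (at x)" for x
    by (auto intro!: derivative_eq_intros)
  have DK: "(?K has_real_derivative ?K1 x) (at x)" if "\<bar>x\<bar> < e" for x
    unfolding K_fun_def
    using DERIV_chain2[OF C_on_2D(1)[OF C2 inS[OF that]] aff] s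
    by (auto intro!: derivative_eq_intros)
  have DK1: "(?K1 has_real_derivative ?K2 x) (at x)" if "\<bar>x\<bar> < e" for x
    using DERIV_chain2[OF C_on_2D(2)[OF C2 inS[OF that]] aff] by (simp add: mult.commute)
  have cK2: "continuous_on (ball 0 e) ?K2"
    using inS ball
    by (intro continuous_intros continuous_on_compose2[OF C_on_2_continuous[OF C2]]) auto
  have Dcgf: "(cgf ?M has_real_derivative ?K1 x) (at x)" if "\<bar>x\<bar> < e" for x
    using that by (intro has_field_derivative_transform_within_open[OF DK open_ball[of 0 e]])
      (auto simp: ball cgf)
  have "C_on 2 (ball 0 e) (cgf ?M)" "C_on 2 (ball 0 e) ?K"
    using Dcgf DK DK1 cK2 by (auto intro!: C_on_2I(1)[OF open_ball] simp only: ball)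
  moreover have "(deriv ^^ j) (cgf ?M) 0 = (deriv ^^ j) ?K 0" for j
  proof (rule higher_deriv_cong_ev)
    have "\<forall>\<^sub>F x in nhds 0. x \<in> ball 0 e" using e by (intro eventually_nhds_in_open) auto
    then show "\<forall>\<^sub>F x in nhds 0. cgf ?M x = ?K x" by eventually_elim (simp add: cgf)
  qed simp
  ultimately show "is_cgf_upto 2 ?M ?K"
    unfolding is_cgf_upto_def using e int ball by blast
  have "(\<lambda>b. b) \<in> borel_measurable ?M"
  proof -
    have "(\<lambda>b. b) \<in> borel_measurable \<nu>"
      by (intro borel_measurable_reference[OF nu]) simp
    then show ?thesis unfolding law_def by (simp add: measurable_restrict_space1)
  qed
  note mom = integrable_sq_exp[where e = e, OF this int] integrable_id_exp[where e = e, OF this int]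
    integral_id_exp[where e = e, OF this int] integral_sq[where e = e, OF this int]
  have Dm: "((\<lambda>x. \<integral>b. exp (x * b) \<partial>?M) has_real_derivative exp (?K x) * ?K1 x) (at x)"
    if x: "\<bar>x\<bar> < e" for x
  proof (rule has_field_derivative_transform_within_open[OF DERIV_fun_exp[OF DK[OF x]] open_ball[of 0 e]])
    show "x \<in> ball 0 e" using x ball by blast
  qed (simp add: mgf)
  have m1: "(\<integral>b. b * exp (x * b) \<partial>?M) = exp (?K x) * ?K1 x" if "\<bar>x\<bar> < e" for x
    using mom(3)[OF _ that Dm[OF that]] .
  have K0: "?K 0 = 0" unfolding K_fun_def by simp
  have i1: "integrable ?M (\<lambda>b. b)" using mom(2)[where x = 0] e by simp
  have i2: "integrable ?M (\<lambda>b. b\<^sup>2)" using mom(1)[where x = 0] e by simp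
  have i0: "integrable ?M (\<lambda>b. 1 :: real)" using int[of 0] e by simp
  have E1: "(\<integral>b. b \<partial>?M) = deriv (fin \<psi>) \<theta>" using m1[of 0] e by (simp add: K0)
  show "mean_is ?M (deriv (fin \<psi>) \<theta>)" unfolding mean_is_def using i1 E1 by blast
  have "((\<lambda>x. exp (?K x) * ?K1 x) has_real_derivative exp (?K 0) * ?K1 0 * ?K1 0 + ?K2 0 * exp (?K 0)) (at 0)"
    using e by (intro DERIV_mult DERIV_fun_exp DK DK1) auto
  then have "((\<lambda>x. \<integral>b. b * exp (x * b) \<partial>?M) has_real_derivative
      exp (?K 0) * ?K1 0 * ?K1 0 + ?K2 0 * exp (?K 0)) (at 0)"
    by (rule has_field_derivative_transform_within_open[OF _ open_ball[of 0 e]])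
      (use e in \<open>auto simp: m1\<close>)
  from mom(4)[OF _ e this]
  have E2: "(\<integral>b. b\<^sup>2 \<partial>?M) = (deriv (fin \<psi>) \<theta>)\<^sup>2 + \<sigma>2 * (deriv ^^ 2) (fin \<psi>) \<theta>"
    by (simp add: K0 power2_eq_square)
  have E0: "(\<integral>b. (1::real) \<partial>?M) = 1" using mgf[of 0] e by (simp add: K0)
  define m where "m = (\<integral>b. b \<partial>?M)"
  have "(\<integral>b. (b - m)\<^sup>2 \<partial>?M) = (\<integral>b. b\<^sup>2 - 2 * m * b + m\<^sup>2 * 1 \<partial>?M)"
    by (simp add: power2_diff algebra_simps)
  also have "\<dots> = (\<integral>b. b\<^sup>2 \<partial>?M) - 2 * m * (\<integral>b. b \<partial>?M) + m\<^sup>2 * (\<integral>b. 1 \<partial>?M)"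
  proof -
    have j: "integrable ?M (\<lambda>b. 2 * m * b)" "integrable ?M (\<lambda>b. m\<^sup>2 * 1)"
      by (intro integrable_mult_right i1 i0)+
    show ?thesis
      unfolding Bochner_Integration.integral_add[OF Bochner_Integration.integrable_diff[OF i2 j(1)] j(2)]
        Bochner_Integration.integral_diff[OF i2 j(1)]
      by (simp only: integral_mult_right_zero)
  qed
  also have "\<dots> = \<sigma>2 * (deriv ^^ 2) (fin \<psi>) \<theta>"
    unfolding E0 E2 m_def E1 by (simp add: power2_eq_square)
  finally show "variance_is ?M (\<sigma>2 * (deriv ^^ 2) (fin \<psi>) \<theta>)"
    unfolding variance_is_def m_def using i1 i2 by blast
qed

section \<open>Quasi-likelihood and regular Legendre exponential dispersion models\<close>

text \<open>Since the slopes of \<open>\<psi>\<close> sweep out the interior of the dual domain, \<open>V\<close> is the reciprocal of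
  the second derivative of the conjugate on the whole interval of integration.\<close>

lemma bregman_eq_quasi_lik:
  assumes f: "legendre \<psi>" and g: "legendre (conjugate \<psi>)"
    and C2: "C_on 2 (interior (eff_dom \<psi>)) (fin \<psi>)"
    and D2: "C_on 2 (interior (eff_dom (conjugate \<psi>))) (fin (conjugate \<psi>))"
    and V: "\<And>t. t \<in> interior (eff_dom \<psi>) \<Longrightarrow>
      (deriv ^^ 2) (fin \<psi>) t = V (deriv (fin \<psi>) t) \<and> V (deriv (fin \<psi>) t) > 0"
    and b: "b \<in> eff_dom (conjugate \<psi>)" and \<mu>: "\<mu> \<in> interior (eff_dom (conjugate \<psi>))"
    and s: "\<sigma>2 > 0"
  shows "bregman (conjugate \<psi>) b \<mu> = - \<sigma>2 * quasi_lik V \<sigma>2 b \<mu>"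
proof -
  let ?h = "(deriv ^^ 2) (fin (conjugate \<psi>))"
  have hV: "?h x = 1 / V x" if x: "x \<in> interior (eff_dom (conjugate \<psi>))" for x
  proof -
    obtain t where t: "t \<in> interior (eff_dom \<psi>)" "deriv (fin \<psi>) t = x"
      using gradient_surj[OF f x] by blast
    have "?h (deriv (fin \<psi>) t) = 1 / (deriv ^^ 2) (fin \<psi>) t"
      by (rule second_deriv_conjugate[OF f g C2 D2 _ t(1)]) (use V in auto)
    then show ?thesis using V[OF t(1)] t(2) by simp
  qed
  have "(LBINT x=\<mu>..b. (b - x) / (\<sigma>2 * V x)) = (LBINT x=\<mu>..b. (b - x) * ?h x / \<sigma>2)"
  proof (rule interval_integral_cong)
    fix x assume "x \<in> einterval (min (ereal \<mu>) (ereal b)) (max (ereal \<mu>) (ereal b))"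
    then have "\<mu> \<le> x \<and> x < b \<or> b < x \<and> x \<le> \<mu>"
      by (auto simp: einterval_iff min_def max_def split: if_splits)
    from hV[OF between_in_interior_dom[OF g b \<mu> this]]
    show "(b - x) / (\<sigma>2 * V x) = (b - x) * ?h x / \<sigma>2" by simp
  qed
  also have "\<dots> = bregman (conjugate \<psi>) b \<mu> / \<sigma>2"
    using bregman_eq_integral[OF g D2 b \<mu>] by simp
  finally show ?thesis using s unfolding quasi_lik_def by simp
qed

theorem mainTheorem3:
  fixes \<psi> :: "real \<Rightarrow> ereal" and V :: "real \<Rightarrow> real" and \<B> :: "real set" and \<sigma>2 :: real
  assumes "legendre \<psi>" and "C_on 2 (interior (eff_dom \<psi>)) (fin \<psi>)"
    and "legendre (conjugate \<psi>)"
    and "C_on 2 (interior (eff_dom (conjugate \<psi>))) (fin (conjugate \<psi>))"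
    and "observation_cond \<psi> \<B>"
    and "\<sigma>2 > 0"
    and "\<forall>\<theta>\<in>interior (eff_dom \<psi>).
           (deriv ^^ 2) (fin \<psi>) \<theta> = V (deriv (fin \<psi>) \<theta>) \<and> V (deriv (fin \<psi>) \<theta>) > 0"
  shows "(\<forall>b\<in>\<B>. \<forall>\<theta>\<in>interior (eff_dom \<psi>). \<forall>\<mu>\<in>interior (eff_dom (conjugate \<psi>)).
            deriv (fin \<psi>) \<theta> = \<mu> \<longrightarrow>
              canonical_div (conjugate \<psi>) b \<theta> = bregman (conjugate \<psi>) b \<mu> \<and>
              bregman (conjugate \<psi>) b \<mu> = - \<sigma>2 * quasi_lik V \<sigma>2 b \<mu>)
       \<and> (\<forall>(\<nu> :: real measure) (p0 :: real \<Rightarrow> real \<Rightarrow> real).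
            eff_dom \<psi> = interior (eff_dom \<psi>) \<longrightarrow>
            reference_measure \<nu> \<B> \<longrightarrow>
            (\<forall>b\<in>\<B>. 0 \<le> p0 b \<sigma>2) \<longrightarrow>
            (\<forall>\<theta>\<in>eff_dom \<psi>. (LINT b:\<B>|\<nu>. p_Q V p0 b (deriv (fin \<psi>) \<theta>) \<sigma>2) = 1) \<longrightarrow>
              (\<forall>\<theta>\<in>eff_dom \<psi>.
                 log_concave_density \<nu> \<B> (\<lambda>b. p0 b \<sigma>2)
                   (\<lambda>b. p_Q V p0 b (deriv (fin \<psi>) \<theta>) \<sigma>2)) \<and>
              regular_LED 2 \<psi> \<B> \<nu> \<sigma>2 (\<lambda>b \<theta> s. p_Q V p0 b (deriv (fin \<psi>) \<theta>) s) \<and>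
              (\<forall>\<theta>\<in>eff_dom \<psi>.
                 variance_is (law \<nu> \<B> (\<lambda>b. p_Q V p0 b (deriv (fin \<psi>) \<theta>) \<sigma>2))
                   (\<sigma>2 * V (deriv (fin \<psi>) \<theta>))))"
proof -
  note f = assms(1) and C2 = assms(2) and g = assms(3) and D2 = assms(4) and s = assms(6)
  let ?S = "interior (eff_dom \<psi>)" and ?g = "conjugate \<psi>"
  have V: "(deriv ^^ 2) (fin \<psi>) t = V (deriv (fin \<psi>) t) \<and> V (deriv (fin \<psi>) t) > 0" if "t \<in> ?S" for t
    using assms(7) that by blast
  have B: "b \<in> eff_dom ?g" if "b \<in> \<B>" for b
    using assms(5) that unfolding observation_cond_def by blast
  have div: "bregman ?g b \<mu> = - \<sigma>2 * quasi_lik V \<sigma>2 b \<mu>"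
    if "b \<in> \<B>" "\<mu> \<in> interior (eff_dom ?g)" for b \<mu>
    by (rule bregman_eq_quasi_lik[OF f g C2 D2 _ B[OF that(1)] that(2) s]) (rule V)
  have grad: "deriv (fin \<psi>) t \<in> interior (eff_dom ?g)" if "t \<in> ?S" for t
    by (rule gradient_in_interior[OF f g C2 _ that]) (use V in auto)
  show ?thesis (is "?I \<and> ?II")
  proof
    show ?I
      using div deriv_biconjugate[OF f] unfolding canonical_div_def by auto
    show ?II
    proof (intro allI impI)
      fix \<nu> :: "real measure" and p0 :: "real \<Rightarrow> real \<Rightarrow> real"
      assume "eff_dom \<psi> = ?S" and nu: "reference_measure \<nu> \<B>"
        and p0: "\<forall>b\<in>\<B>. 0 \<le> p0 b \<sigma>2"
        and norm: "\<forall>\<theta>\<in>eff_dom \<psi>. (LINT b:\<B>|\<nu>. p_Q V p0 b (deriv (fin \<psi>) \<theta>) \<sigma>2) = 1"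
      then have S: "t \<in> ?S \<longleftrightarrow> t \<in> eff_dom \<psi>" and op: "open (eff_dom \<psi>)" for t
        by (simp_all add: interior_eq[symmetric])
      let ?p = "\<lambda>t b. p_Q V p0 b (deriv (fin \<psi>) t) \<sigma>2"
      have Q: "quasi_lik V \<sigma>2 b (deriv (fin \<psi>) t) = (b * t - fin \<psi> t - fin ?g b) / \<sigma>2"
        if t: "t \<in> ?S" and b: "b \<in> \<B>" for t b
      proof -
        have "bregman ?g b (deriv (fin \<psi>) t) = fin ?g b + fin \<psi> t - b * t"
          unfolding bregman_def gradient_in_dom(2)[OF f t] deriv_conjugate_gradient[OF f g t grad[OF t]]
          by (simp add: algebra_simps)
        then show ?thesis using div[OF b grad[OF t]] s by (simp add: field_simps)
      qed
      have dens: "is_density \<nu> \<B> (?p t)" if "t \<in> eff_dom \<psi>" for t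
        using norm p0 that unfolding is_density_def p_Q_def by simp
      \<comment> \<open>the base measure of the exponential family: the part of \<open>exp Q\<close> depending only on \<open>b\<close> joins \<open>p0\<close>\<close>
      define h where "h b = exp (- fin ?g b / \<sigma>2) * p0 b \<sigma>2" for b
      have p: "?p t b = exp ((b * t - fin \<psi> t) / \<sigma>2) * h b" if "t \<in> eff_dom \<psi>" "b \<in> \<B>" for t b
      proof -
        have "quasi_lik V \<sigma>2 b (deriv (fin \<psi>) t) = (b * t - fin \<psi> t) / \<sigma>2 + - fin ?g b / \<sigma>2"
          using Q[OF _ that(2), of t] S that(1) by (simp add: diff_divide_distrib)
        then show ?thesis unfolding p_Q_def h_def by (simp only: exp_add mult.assoc)
      qed
      have mom: "mean_is (law \<nu> \<B> (?p t)) (deriv (fin \<psi>) t)"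
        "is_cgf_upto 2 (law \<nu> \<B> (?p t)) (K_fun \<psi> t \<sigma>2)"
        "variance_is (law \<nu> \<B> (?p t)) (\<sigma>2 * (deriv ^^ 2) (fin \<psi>) t)" if "t \<in> eff_dom \<psi>" for t
        using exponential_family_moments[where p = ?p and h = h, OF C2 open_interior s _ nu]
          dens p S that by simp_all
      have lc: "log_concave_density \<nu> \<B> (\<lambda>b. p0 b \<sigma>2) (?p t)" if t: "t \<in> eff_dom \<psi>" for t
        unfolding log_concave_density_def
      proof (intro conjI exI[of _ "\<lambda>x. ereal (1 / \<sigma>2) * ?g x + ereal (fin \<psi> t / \<sigma>2 + - t / \<sigma>2 * x)"] ballI)
        have s': "1 / \<sigma>2 > 0" using s by simp
        note aff = legendre_scale_add_affine[where c = "fin \<psi> t / \<sigma>2" and d = "- t / \<sigma>2", OF g s']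
        show "is_density \<nu> \<B> (?p t)" using dens[OF t] .
        show "legendre (\<lambda>x. ereal (1 / \<sigma>2) * ?g x + ereal (fin \<psi> t / \<sigma>2 + - t / \<sigma>2 * x))"
          by (rule aff(1))
        show "\<B> \<subseteq> eff_dom (\<lambda>x. ereal (1 / \<sigma>2) * ?g x + ereal (fin \<psi> t / \<sigma>2 + - t / \<sigma>2 * x))"
          unfolding aff(2) using B by blast
        fix b assume b: "b \<in> \<B>"
        show "?p t b = exp (- fin (\<lambda>x. ereal (1 / \<sigma>2) * ?g x + ereal (fin \<psi> t / \<sigma>2 + - t / \<sigma>2 * x)) b) * p0 b \<sigma>2"
          unfolding aff(3)[OF B[OF b]] p_Q_def Q[OF S[THEN iffD2, OF t] b]
          using s by (simp add: field_simps)
      qed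
      have "LED 2 \<psi> \<B> \<nu> \<sigma>2 (\<lambda>b \<theta> s. p_Q V p0 b (deriv (fin \<psi>) \<theta>) s)"
        unfolding LED_def
      proof (intro conjI)
        show "\<exists>p1. (\<forall>b\<in>\<B>. 0 \<le> p1 b \<sigma>2) \<and> (\<forall>\<theta>\<in>eff_dom \<psi>. \<forall>b\<in>\<B>.
            ?p \<theta> b = exp ((b * \<theta> - fin \<psi> \<theta>) / \<sigma>2) * p1 b \<sigma>2)"
          using p p0 by (intro exI[of _ "\<lambda>b _. h b"]) (simp add: h_def)
        show "\<forall>\<theta>\<in>?S. mean_is (law \<nu> \<B> (?p \<theta>)) (deriv (fin \<psi>) \<theta>) \<and>
            is_cgf_upto 2 (law \<nu> \<B> (?p \<theta>)) (K_fun \<psi> \<theta> \<sigma>2)"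
          using mom S by blast
      qed (use f C2 s assms(5) nu dens in auto)
      then have "regular_LED 2 \<psi> \<B> \<nu> \<sigma>2 (\<lambda>b \<theta> s. p_Q V p0 b (deriv (fin \<psi>) \<theta>) s)"
        unfolding regular_LED_def using op by blast
      moreover have "variance_is (law \<nu> \<B> (?p t)) (\<sigma>2 * V (deriv (fin \<psi>) t))"
        if t: "t \<in> eff_dom \<psi>" for t
        using mom(3)[OF t] V[of t] S t by simp
      ultimately show "(\<forall>\<theta>\<in>eff_dom \<psi>. log_concave_density \<nu> \<B> (\<lambda>b. p0 b \<sigma>2) (?p \<theta>)) \<and>
          regular_LED 2 \<psi> \<B> \<nu> \<sigma>2 (\<lambda>b \<theta> s. p_Q V p0 b (deriv (fin \<psi>) \<theta>) s) \<and>
          (\<forall>\<theta>\<in>eff_dom \<psi>. variance_is (law \<nu> \<B> (?p \<theta>)) (\<sigma>2 * V (deriv (fin \<psi>) \<theta>)))"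
        using lc by blast
    qed
  qed
qed

end
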